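(* Let $G$ be a compact Hausdorff topological group with a countable basis and more than one element, and let $\mu=(\mu_k:k\in-\mathbb{N})$ be a family of Borel probability laws on $G$. For any extremal solution $\{(\eta^0_k),(\xi_k)\}$ with noise law $\mu$, there exist a sequence $(\alpha_l)_{l\in-\mathbb{N}}$ of deterministic elements of $G$ and a compact subgroup $H$ of $G$ such that the following four conditions hold: (E1) $\xi_k\xi_{k-1}\cdots\xi_l\,\alpha_l$ converges in law to $\eta^0_k$ as $l\to-\infty$, for each $k\in-\mathbb{N}$; (E2) $\alpha_l^{-1}\eta^0_{l-1}$ converges in law to $U_H$ as $l\to-\infty$, where $U_H$ is uniform on $H$ (i.e. its law is the normalized Haar measure of $H$); (E3) for each $h\in H$, the process $(\eta^0_k h)_{k\in-\mathbb{N}}$ has the same law on $G^{-\mathbb{N}}$ as $(\eta^0_k)_{k\in-\mathbb{N}}$; (E4) $\xi_k\xi_{k-1}\cdots\xi_l\,\alpha_l H\to\eta^0_k H$ almost surely in $G/H$ as $l\to-\infty$, for each $k\in-\mathbb{N}$. If, moreover, $\{(\tilde\eta^0_k),(\tilde\xi_k)\}$ is another extremal solution with noise law $\mu$ which satisfies (E1)-(E4) with a sequence $(\tilde\alpha_l)$ of deterministic elements of $G$ and a compact subgroup $\tilde H$ of $G$ (in place of $(\alpha_l)$ and $H$), then $$(\tilde\eta^0_k)_{k\in-\mathbb{N}}\ \text{has the same law as}\ (\eta^0_k g)_{k\in-\mathbb{N}},\qquad \tilde H=g^{-1}Hg$$ for every accumulation point $g$ of the sequence $(\alpha_l^{-1}\tilde\alpha_l)_{l\in-\mathbb{N}}$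 as $l\to-\infty$ (i.e. every limit along a subsequence $l(j)\to-\infty$).
   Context: $\mathbb{N}=\{0,1,2,\ldots\}$ and $-\mathbb{N}=\{0,-1,-2,\ldots\}$. A solution (with noise law $\mu$) is a pair of $G$-valued processes $\{(\eta_k)_{k\in-\mathbb{N}},(\xi_k)_{k\in-\mathbb{N}}\}$ defined on a common probability space such that, for every $k\in-\mathbb{N}$: $\eta_k=\xi_k\eta_{k-1}$ a.s.; $\xi_k$ is independent of $\mathcal{F}^\eta_{k-1}:=\sigma(\eta_m:m\le k-1)$; and $\xi_k$ has law $\mu_k$. Let $\mathscr{P}_\mu$ be the set of laws on $G^{-\mathbb{N}}$ of $(\eta_k)$ for all possible solutions; it is a compact convex subset of the set of probability laws on $G^{-\mathbb{N}}$ (weak convergence topology). A solution is extremal if the law of $(\eta_k)$ is an extremal point of $\mathscr{P}_\mu$. For a compact subgroup $H$, $G/H$ is the set of left cosets $gH$ with the quotient topology (compact and metrizable). *)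

theory Defs
  imports "HOL-Probability.Probability"
begin

text \<open>
  The group is written additively: the class \<open>topological_group_add\<close> does not assume
  commutativity, so \<open>g + h\<close>, \<open>- g\<close>, \<open>0\<close> stand for the product \<open>gh\<close>, the inverse and the
  neutral element of a possibly non-abelian group, and the order of summands matters.

  Time runs through the non-positive integers \<open>{..0::int}\<close>; the values of a process or of a
  sequence at positive indices play no role anywhere. Limits \<open>l \<rightarrow> -\<infinity>\<close> are taken
  along the filter \<open>at_bot\<close> on \<open>int\<close>.
\<close>

definition past_events :: "'w measure \<Rightarrow> (int \<Rightarrow> 'w \<Rightarrow> 'a::topological_space) \<Rightarrow> int \<Rightarrow> 'w set set"
  where "past_events M \<eta> j =
    sigma_sets (space M) {\<eta> m -` A \<inter> space M | m A. m \<le> j \<and> A \<in> sets borel}"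

definition solution ::
  "(int \<Rightarrow> 'a::topological_group_add measure) \<Rightarrow> 'w measure
    \<Rightarrow> (int \<Rightarrow> 'w \<Rightarrow> 'a) \<Rightarrow> (int \<Rightarrow> 'w \<Rightarrow> 'a) \<Rightarrow> bool"
  where "solution \<mu> M \<eta> \<xi> \<longleftrightarrow>
    prob_space M \<and>
    (\<forall>k\<le>0. \<eta> k \<in> borel_measurable M \<and> \<xi> k \<in> borel_measurable M) \<and>
    (\<forall>k\<le>0. (AE \<omega> in M. \<eta> k \<omega> = \<xi> k \<omega> + \<eta> (k - 1) \<omega>) \<and>
      prob_space.indep_set M {\<xi> k -` A \<inter> space M | A. A \<in> sets borel} (past_events M \<eta> (k - 1)) \<and>
      distr M borel (\<xi> k) = \<mu> k)"

text \<open>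
  For second countable spaces the product \<open>\<sigma>\<close>-algebra used here is the Borel
  \<open>\<sigma>\<close>-algebra of the product topology.
\<close>

definition process_law :: "'w measure \<Rightarrow> (int \<Rightarrow> 'w \<Rightarrow> 'a::topological_space) \<Rightarrow> (int \<Rightarrow> 'a) measure"
  where "process_law M X = distr M (PiM {..0} (\<lambda>_. borel)) (\<lambda>\<omega>. \<lambda>k\<in>{..0}. X k \<omega>)"

text \<open>
  HOL cannot quantify over probability spaces of all types inside a definition, so the set of
  laws of solutions is formed from solutions living on one fixed type of sample points, rich
  enough to carry a pair of \<open>G\<close>-valued processes. Lemma \<open>process_law_in_solution_laws\<close>
  below shows that the law of a solution on an arbitrary probability space belongs to the set.
\<close>

definition solution_laws :: "(int \<Rightarrow> 'a::topological_group_add measure) \<Rightarrow> (int \<Rightarrow> 'a) measure set"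
  where "solution_laws \<mu> =
    {process_law M \<eta> | (M :: ((int \<Rightarrow> 'a) \<times> (int \<Rightarrow> 'a)) measure) \<eta> \<xi>. solution \<mu> M \<eta> \<xi>}"

definition extremal_law :: "(int \<Rightarrow> 'a::topological_group_add measure) \<Rightarrow> (int \<Rightarrow> 'a) measure \<Rightarrow> bool"
  where "extremal_law \<mu> P \<longleftrightarrow>
    P \<in> solution_laws \<mu> \<and>
    (\<forall>P1\<in>solution_laws \<mu>. \<forall>P2\<in>solution_laws \<mu>. \<forall>t::real. 0 < t \<and> t < 1 \<and>
      (\<forall>A\<in>sets P. measure P A = t * measure P1 A + (1 - t) * measure P2 A)
        \<longrightarrow> P1 = P \<and> P2 = P)"

definition extremal_solution ::
  "(int \<Rightarrow> 'a::topological_group_add measure) \<Rightarrow> 'w measure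
    \<Rightarrow> (int \<Rightarrow> 'w \<Rightarrow> 'a) \<Rightarrow> (int \<Rightarrow> 'w \<Rightarrow> 'a) \<Rightarrow> bool"
  where "extremal_solution \<mu> M \<eta> \<xi> \<longleftrightarrow>
    solution \<mu> M \<eta> \<xi> \<and> extremal_law \<mu> (process_law M \<eta>)"

definition weakly_converges ::
  "('i \<Rightarrow> 'a::topological_space measure) \<Rightarrow> 'a measure \<Rightarrow> 'i filter \<Rightarrow> bool"
  where "weakly_converges \<nu> \<nu>' F \<longleftrightarrow>
    (\<forall>f::'a \<Rightarrow> real. continuous_on UNIV f \<and> bounded (range f) \<longrightarrow>
      ((\<lambda>i. integral\<^sup>L (\<nu> i) f) \<longlongrightarrow> integral\<^sup>L \<nu>' f) F)"

definition compact_subgroup :: "'a::topological_group_add set \<Rightarrow> bool"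
  where "compact_subgroup H \<longleftrightarrow>
    compact H \<and> 0 \<in> H \<and> (\<forall>g\<in>H. \<forall>h\<in>H. g + h \<in> H) \<and> (\<forall>h\<in>H. - h \<in> H)"

text \<open>The normalized Haar measure of \<open>H\<close>, as a Borel measure on the whole group carried by \<open>H\<close>.\<close>

definition normalized_haar :: "'a::topological_group_add set \<Rightarrow> 'a measure \<Rightarrow> bool"
  where "normalized_haar H \<nu> \<longleftrightarrow>
    sets \<nu> = sets borel \<and> prob_space \<nu> \<and> emeasure \<nu> H = 1 \<and>
    (\<forall>h\<in>H. distr \<nu> borel (\<lambda>x. h + x) = \<nu>)"

definition lcoset :: "'a::plus \<Rightarrow> 'a set \<Rightarrow> 'a set"
  where "lcoset g H = (\<lambda>h. g + h) ` H"

definition coset_topology :: "'a::topological_group_add set \<Rightarrow> 'a set topology"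
  where "coset_topology H =
    topology (\<lambda>U. U \<subseteq> range (\<lambda>g. lcoset g H) \<and> open {g. lcoset g H \<in> U})"

lemma openin_coset_topology:
  "openin (coset_topology H) U \<longleftrightarrow> U \<subseteq> range (\<lambda>g. lcoset g H) \<and> open {g. lcoset g H \<in> U}"
proof -
  have "istopology (\<lambda>U. U \<subseteq> range (\<lambda>g. lcoset g H) \<and> open {g. lcoset g H \<in> U})"
  proof (unfold istopology_def, intro conjI allI impI)
    fix S T :: "'a set set"
    assume "S \<subseteq> range (\<lambda>g. lcoset g H) \<and> open {g. lcoset g H \<in> S}"
      and "T \<subseteq> range (\<lambda>g. lcoset g H) \<and> open {g. lcoset g H \<in> T}"
    moreover have "{g. lcoset g H \<in> S \<inter> T} = {g. lcoset g H \<in> S} \<inter> {g. lcoset g H \<in> T}"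
      by auto
    ultimately show "S \<inter> T \<subseteq> range (\<lambda>g. lcoset g H)" and "open {g. lcoset g H \<in> S \<inter> T}"
      by auto
  next
    fix K :: "'a set set set"
    assume K: "\<forall>S\<in>K. S \<subseteq> range (\<lambda>g. lcoset g H) \<and> open {g. lcoset g H \<in> S}"
    have "{g. lcoset g H \<in> \<Union>K} = (\<Union>S\<in>K. {g. lcoset g H \<in> S})"
      by auto
    with K show "\<Union>K \<subseteq> range (\<lambda>g. lcoset g H)" and "open {g. lcoset g H \<in> \<Union>K}"
      by auto
  qed
  then show ?thesis
    by (simp add: coset_topology_def topology_inverse')
qed

lemma topspace_coset_topology: "topspace (coset_topology H) = range (\<lambda>g. lcoset g H)"
proof -
  have "{g. lcoset g H \<in> range (\<lambda>g. lcoset g H)} = UNIV"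
    by auto
  then have "openin (coset_topology H) (range (\<lambda>g. lcoset g H))"
    by (simp add: openin_coset_topology)
  then show ?thesis
    by (metis openin_coset_topology openin_subset openin_topspace subset_antisym)
qed

lemma quotient_map_lcoset: "quotient_map euclidean (coset_topology H) (\<lambda>g. lcoset g H)"
  by (auto simp: quotient_map_def topspace_coset_topology openin_coset_topology)

text \<open>\<open>noise_product \<xi> k l \<omega>\<close> is \<open>\<xi>\<^sub>k \<xi>\<^sub>k\<^sub>-\<^sub>1 \<dots> \<xi>\<^sub>l\<close> (in this order), the empty product if \<open>l > k\<close>.\<close>

definition noise_product :: "(int \<Rightarrow> 'w \<Rightarrow> 'a::monoid_add) \<Rightarrow> int \<Rightarrow> int \<Rightarrow> 'w \<Rightarrow> 'a"
  where "noise_product \<xi> k l \<omega> = sum_list (map (\<lambda>i. \<xi> i \<omega>) (rev [l..k]))"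

definition cond_E1 ::
  "'w measure \<Rightarrow> (int \<Rightarrow> 'w \<Rightarrow> 'a::topological_group_add) \<Rightarrow> (int \<Rightarrow> 'w \<Rightarrow> 'a) \<Rightarrow> (int \<Rightarrow> 'a) \<Rightarrow> bool"
  where "cond_E1 M \<eta> \<xi> \<alpha> \<longleftrightarrow>
    (\<forall>k\<le>0. weakly_converges (\<lambda>l. distr M borel (\<lambda>\<omega>. noise_product \<xi> k l \<omega> + \<alpha> l))
      (distr M borel (\<eta> k)) at_bot)"

definition cond_E2 ::
  "'w measure \<Rightarrow> (int \<Rightarrow> 'w \<Rightarrow> 'a::topological_group_add) \<Rightarrow> (int \<Rightarrow> 'a) \<Rightarrow> 'a set \<Rightarrow> bool"
  where "cond_E2 M \<eta> \<alpha> H \<longleftrightarrow>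
    (\<exists>\<nu>. normalized_haar H \<nu> \<and>
      weakly_converges (\<lambda>l. distr M borel (\<lambda>\<omega>. - \<alpha> l + \<eta> (l - 1) \<omega>)) \<nu> at_bot)"

definition cond_E3 ::
  "'w measure \<Rightarrow> (int \<Rightarrow> 'w \<Rightarrow> 'a::topological_group_add) \<Rightarrow> 'a set \<Rightarrow> bool"
  where "cond_E3 M \<eta> H \<longleftrightarrow>
    (\<forall>h\<in>H. process_law M (\<lambda>k \<omega>. \<eta> k \<omega> + h) = process_law M \<eta>)"

definition cond_E4 ::
  "'w measure \<Rightarrow> (int \<Rightarrow> 'w \<Rightarrow> 'a::topological_group_add) \<Rightarrow> (int \<Rightarrow> 'w \<Rightarrow> 'a)
    \<Rightarrow> (int \<Rightarrow> 'a) \<Rightarrow> 'a set \<Rightarrow> bool"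
  where "cond_E4 M \<eta> \<xi> \<alpha> H \<longleftrightarrow>
    (\<forall>k\<le>0. AE \<omega> in M. limitin (coset_topology H)
      (\<lambda>l. lcoset (noise_product \<xi> k l \<omega> + \<alpha> l) H) (lcoset (\<eta> k \<omega>) H) at_bot)"

lemma process_measurable:
  assumes "\<And>k. k \<le> 0 \<Longrightarrow> X k \<in> borel_measurable M"
  shows "(\<lambda>\<omega>. \<lambda>k\<in>{..0::int}. X k \<omega>) \<in> measurable M (PiM {..0} (\<lambda>_. borel))"
  using assms by (intro measurable_restrict) auto

lemma process_law_in_solution_laws:
  fixes \<mu> :: "int \<Rightarrow> 'a::{topological_group_add, second_countable_topology, t2_space} measure"
    and M :: "'w measure"
  assumes sol: "solution \<mu> M \<eta> \<xi>"
  shows "process_law M \<eta> \<in> solution_laws \<mu>"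
proof -
  let ?S = "PiM {..0::int} (\<lambda>_. borel :: 'a measure)"
  define T where "T \<omega> = ((\<lambda>k\<in>{..0::int}. \<eta> k \<omega>), (\<lambda>k\<in>{..0::int}. \<xi> k \<omega>))" for \<omega>
  define N where "N = distr M (?S \<Otimes>\<^sub>M ?S) T"
  define e where "e k x = fst x k" for k and x :: "(int \<Rightarrow> 'a) \<times> (int \<Rightarrow> 'a)"
  define z where "z k x = snd x k" for k and x :: "(int \<Rightarrow> 'a) \<times> (int \<Rightarrow> 'a)"
  interpret M: prob_space M
    using sol by (simp add: solution_def)
  have m\<eta>: "\<eta> k \<in> borel_measurable M" and m\<xi>: "\<xi> k \<in> borel_measurable M" if "k \<le> 0" for k
    using sol that by (auto simp: solution_def)
  have T: "T \<in> measurable M (?S \<Otimes>\<^sub>M ?S)"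
    unfolding T_def by (intro measurable_Pair process_measurable m\<eta> m\<xi>)
  interpret N: prob_space N
    unfolding N_def by (rule M.prob_space_distr[OF T])
  have spN: "space N = space (?S \<Otimes>\<^sub>M ?S)" and sN: "sets N = sets (?S \<Otimes>\<^sub>M ?S)"
    by (simp_all add: N_def)
  have e: "e k \<in> borel_measurable N" and z: "z k \<in> borel_measurable N" if "k \<le> 0" for k
  proof -
    have c: "(\<lambda>x. x k) \<in> borel_measurable ?S"
      using that by (intro measurable_component_singleton) auto
    show "e k \<in> borel_measurable N" "z k \<in> borel_measurable N"
      unfolding e_def[abs_def] z_def[abs_def] measurable_cong_sets[OF sN refl]
      using measurable_compose[OF measurable_fst c] measurable_compose[OF measurable_snd c]
      by auto
  qed
  have eT: "e k (T \<omega>) = \<eta> k \<omega>" and zT: "z k (T \<omega>) = \<xi> k \<omega>" if "k \<le> 0" for k \<omega>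
    using that by (auto simp: e_def z_def T_def)
  have Tsp: "T \<omega> \<in> space N" if "\<omega> \<in> space M" for \<omega>
    using measurable_space[OF T that] by (simp add: spN)
  have "prob_space.indep_set N {z k -` A \<inter> space N | A. A \<in> sets borel} (past_events N e (k - 1))"
    if k: "k \<le> 0" for k
  proof -
    have ind: "M.indep_set {\<xi> k -` A \<inter> space M | A. A \<in> sets borel} (past_events M \<eta> (k - 1))"
      using sol k by (simp add: solution_def)
    have sub: "past_events N e (k - 1) \<subseteq> sets N"
      unfolding past_events_def using e k
      by (intro sets.sigma_sets_subset) (auto intro!: measurable_sets)
    have pre: "T -` B \<inter> space M \<in> past_events M \<eta> (k - 1)" if "B \<in> past_events N e (k - 1)" for B
      using that unfolding past_events_def
    proof (induction rule: sigma_sets.induct)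
      case (Basic B)
      then obtain m A where m: "B = e m -` A \<inter> space N" "m \<le> k - 1" "A \<in> sets borel"
        by auto
      have em: "e m (T \<omega>) = \<eta> m \<omega>" for \<omega>
        using m k by (intro eT) simp
      have "T -` B \<inter> space M = \<eta> m -` A \<inter> space M"
        unfolding m(1) by (intro set_eqI) (use Tsp in \<open>auto simp: em simp del: split_paired_All\<close>)
      with m show ?case by (auto intro!: sigma_sets.Basic)
    next
      case Empty
      show ?case by (simp add: sigma_sets.Empty)
    next
      case (Compl B)
      have "T -` (space N - B) \<inter> space M = space M - (T -` B \<inter> space M)"
        using Tsp by auto
      with Compl show ?case by (simp add: sigma_sets.Compl)
    next
      case (Union B)
      have "T -` (\<Union>i. B i) \<inter> space M = (\<Union>i. T -` B i \<inter> space M)"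
        by auto
      then show ?case by (simp only:) (intro sigma_sets.Union Union.IH)
    qed
    have prob: "N.prob B = M.prob (T -` B \<inter> space M)" if "B \<in> sets N" for B
      unfolding N_def using that by (intro measure_distr T) (simp add: sN)
    show ?thesis
      unfolding N.indep_sets2_eq
    proof (intro conjI ballI)
      show "{z k -` A \<inter> space N | A. A \<in> sets borel} \<subseteq> N.events"
        using z[OF k] by (auto intro!: measurable_sets)
      show "past_events N e (k - 1) \<subseteq> N.events" by fact
      fix a b assume "a \<in> {z k -` A \<inter> space N | A. A \<in> sets borel}"
        and b: "b \<in> past_events N e (k - 1)"
      then obtain A where A: "a = z k -` A \<inter> space N" "A \<in> sets borel" by auto
      have Ta: "T -` a \<inter> space M = \<xi> k -` A \<inter> space M"
        unfolding A(1) by (intro set_eqI) (use Tsp in \<open>auto simp: zT[OF k] simp del: split_paired_All\<close>)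
      have a': "a \<in> sets N" using A z[OF k] by (auto intro!: measurable_sets)
      have b': "b \<in> sets N" using b sub by auto
      have "N.prob (a \<inter> b) = M.prob ((T -` a \<inter> space M) \<inter> (T -` b \<inter> space M))"
        using prob[of "a \<inter> b"] a' b' by (simp add: vimage_Int Int_ac)
      also have "\<dots> = M.prob (T -` a \<inter> space M) * M.prob (T -` b \<inter> space M)"
        using M.indep_setD[OF ind, of "T -` a \<inter> space M" "T -` b \<inter> space M"] pre[OF b] A
        unfolding Ta by auto
      finally show "N.prob (a \<inter> b) = N.prob a * N.prob b"
        using prob a' b' by simp
    qed
  qed
  moreover have "AE x in N. e k x = z k x + e (k - 1) x" if k: "k \<le> 0" for k
  proof -
    have [measurable]: "e k \<in> borel_measurable N" "z k \<in> borel_measurable N"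
      "e (k - 1) \<in> borel_measurable N"
      using k e z by auto
    have "{x \<in> space N. e k x = z k x + e (k - 1) x} \<in> sets N"
      by measurable
    then show ?thesis
      using sol k eT zT unfolding N_def
      by (subst AE_distr_iff[OF T]) (auto simp: solution_def spN sN N_def)
  qed
  moreover have "distr N borel (z k) = \<mu> k" if k: "k \<le> 0" for k
  proof -
    have "distr N borel (z k) = distr M borel (z k \<circ> T)"
      unfolding N_def using z[OF k] by (intro distr_distr T) (simp add: N_def)
    also have "z k \<circ> T = \<xi> k" using zT[OF k] by auto
    finally show ?thesis using sol k by (simp add: solution_def)
  qed
  ultimately have "solution \<mu> N e z"
    using e z N.prob_space_axioms by (auto simp: solution_def)
  moreover have "process_law N e = process_law M \<eta>"
  proof -
    have m: "(\<lambda>x. \<lambda>k\<in>{..0}. e k x) \<in> measurable (?S \<Otimes>\<^sub>M ?S) ?S"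
      using process_measurable[of e N] e by (simp add: N_def)
    have "process_law N e = distr M ?S ((\<lambda>x. \<lambda>k\<in>{..0}. e k x) \<circ> T)"
      unfolding process_law_def N_def by (rule distr_distr[OF m T])
    also have "(\<lambda>x. \<lambda>k\<in>{..0}. e k x) \<circ> T = (\<lambda>\<omega>. \<lambda>k\<in>{..0}. \<eta> k \<omega>)"
      by (auto simp: eT fun_eq_iff restrict_def)
    finally show ?thesis by (simp only: process_law_def)
  qed
  ultimately show ?thesis
    unfolding solution_laws_def by (smt (verit, best) mem_Collect_eq)
qed

end

theory Submission
  imports Defs
begin

text \<open>
  An extremal solution has a trivial tail, since conditioning on a tail event yields again a
  solution. Backward martingale convergence then shows that, for almost every \<open>\<omega>\<close>, the laws of
  \<open>\<xi>\<^sub>k \<dots> \<xi>\<^sub>l \<eta>\<^sub>l\<^sub>-\<^sub>1(\<omega>)\<close> converge to the law of \<open>\<eta>\<^sub>k\<close> as \<open>l \<rightarrow> -\<infinity>\<close>, so \<open>\<alpha>\<^sub>l = \<eta>\<^sub>l\<^sub>-\<^sub>1(\<omega>\<^sub>0)\<close> satisfies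
  (E1) for a suitable \<open>\<omega>\<^sub>0\<close>. Let \<open>H\<close> be the group of all \<open>h\<close> such that \<open>\<eta>\<^sub>kh\<close> and \<open>\<eta>\<^sub>k\<close> have the same
  law for every \<open>k\<close>. If two sequences \<open>\<alpha>\<close> and \<open>\<beta>\<close> both satisfy (E1), every accumulation point of
  \<open>\<alpha>\<^sub>l\<^sup>-\<^sup>1\<beta>\<^sub>l\<close> lies in \<open>H\<close>; hence \<open>\<alpha>\<^sub>l\<^sup>-\<^sup>1\<eta>\<^sub>l\<^sub>-\<^sub>1\<close> approaches \<open>H\<close> almost surely, which is (E4). As the law of
  \<open>\<alpha>\<^sub>l\<^sup>-\<^sup>1\<eta>\<^sub>l\<^sub>-\<^sub>1\<close> is right \<open>H\<close>-invariant, averaging over \<open>H\<close> gives (E2). Uniqueness follows from (E1),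
  because the laws of \<open>\<xi>\<^sub>k \<dots> \<xi>\<^sub>l\<close> depend on \<open>\<mu>\<close> only, and from (E2), because a compact subgroup is
  determined by its Haar measure.
\<close>

text \<open>Weak convergence is tested by uncountably many functions, whereas null sets can be
  joined only countably often; hence a countable family of Borel sets that controls weak
  convergence. No metric is fixed on the group: compactness, the Hausdorff property and a countable
  basis are used directly. The noise acts on the left, so right translation maps solutions to
  solutions; this is why \<open>H\<close> and \<open>g\<close> act on the right. \<open>H\<close> is
  defined by one-time marginals because (E1) sees nothing else. A solution is Markov with
  transitions given by \<open>\<mu>\<close>, so equal marginals at all times force equal path laws;
  this yields (E3) and the law in the uniqueness part. Independence is assumed only between
  \<open>\<xi> k\<close> and the past of \<open>\<eta>\<close>, not among the noises; products of
  noises become tractable because they telescope to differences of values of \<open>\<eta>\<close>.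
  Haar measure on \<open>H\<close> is constructed from the right \<open>H\<close>-invariant law of
  \<open>\<eta> 0\<close>.\<close>

section \<open>Weak convergence on a compact space\<close>

lemma borel_measurable_group_uminus:
  fixes f :: "'b \<Rightarrow> 'a::{topological_group_add, t2_space}"
  assumes "f \<in> borel_measurable N"
  shows "(\<lambda>x. - f x) \<in> borel_measurable N"
  by (rule borel_measurable_continuous_on[OF _ assms]) (intro continuous_intros)

lemma bounded_range_continuous:
  fixes f :: "'a::topological_space \<Rightarrow> real"
  assumes "compact (UNIV :: 'a set)" "continuous_on UNIV f"
  shows "bounded (range f)"
  using compact_continuous_image[OF assms(2,1)] by (rule compact_imp_bounded)

lemma integrable_continuous_compact:
  fixes f :: "'a::topological_space \<Rightarrow> real"
  assumes "compact (UNIV :: 'a set)" "continuous_on UNIV f" "prob_space P" "sets P = sets borel"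
  shows "integrable P f"
proof -
  interpret prob_space P by fact
  obtain c where "\<And>x. norm (f x) \<le> c"
    using bounded_range_continuous[OF assms(1,2)] by (auto simp: bounded_iff)
  moreover have "f \<in> borel_measurable P"
    using borel_measurable_continuous_onI[OF assms(2)] assms(4) by (simp cong: measurable_cong_sets)
  ultimately show ?thesis by (intro integrable_const_bound[of _ c]) auto
qed

lemma (in prob_space) abs_expectation_le:
  fixes f :: "'a \<Rightarrow> real"
  assumes "integrable M f" "\<And>x. \<bar>f x\<bar> \<le> c"
  shows "\<bar>expectation f\<bar> \<le> c"
proof -
  have "\<bar>expectation f\<bar> \<le> expectation (\<lambda>x. \<bar>f x\<bar>)"
    by (rule integral_abs_bound)
  also have "\<dots> \<le> c"
    using assms by (intro integral_le_const) auto
  finally show ?thesis .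
qed

lemma weakly_converges_compose:
  assumes "weakly_converges P Q F" "filterlim r F G"
  shows "weakly_converges (\<lambda>j. P (r j)) Q G"
  using assms unfolding weakly_converges_def by (auto intro: filterlim_compose)

text \<open>By compactness in the second variable, continuity in the first is uniform in the second.
  Replacing \<open>g i\<close> by its limit therefore costs an error that is small for all the laws
  \<open>P i\<close> at once.\<close>

lemma weakly_converges_integral_pair:
  fixes f :: "'b::topological_space \<times> 'a::topological_space \<Rightarrow> real"
  assumes cpt: "compact (UNIV :: 'a set)" and f: "continuous_on UNIV f"
    and P: "\<And>i. prob_space (P i)" "\<And>i. sets (P i) = sets borel"
    and w: "weakly_converges P Q F" and g: "(g \<longlongrightarrow> g0) F"
  shows "((\<lambda>i. \<integral>x. f (g i, x) \<partial>P i) \<longlongrightarrow> (\<integral>x. f (g0, x) \<partial>Q)) F"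
proof -
  have sect: "continuous_on UNIV (\<lambda>x. f (y, x))" for y
    by (rule continuous_on_compose2[OF f]) (auto intro!: continuous_intros)
  have "((\<lambda>i. \<integral>x. f (g0, x) \<partial>P i) \<longlongrightarrow> (\<integral>x. f (g0, x) \<partial>Q)) F"
    using w sect bounded_range_continuous[OF cpt sect] unfolding weakly_converges_def by blast
  moreover have "((\<lambda>i. (\<integral>x. f (g i, x) \<partial>P i) - (\<integral>x. f (g0, x) \<partial>P i)) \<longlongrightarrow> 0) F"
  proof (rule tendstoI)
    fix e :: real assume e: "e > 0"
    obtain X0 where X0: "g0 \<in> X0" "open X0" "\<forall>y\<in>X0 \<inter> UNIV. \<forall>x\<in>UNIV. dist (f (y, x)) (f (g0, x)) \<le> e/2"
      using continuous_on_prod_compactE[of UNIV UNIV f g0 "e/2"] f cpt e by auto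
    have "eventually (\<lambda>i. g i \<in> X0) F"
      using g X0(1,2) by (simp add: tendsto_def)
    then show "eventually (\<lambda>i. dist ((\<integral>x. f (g i, x) \<partial>P i) - (\<integral>x. f (g0, x) \<partial>P i)) 0 < e) F"
    proof eventually_elim
      case (elim i)
      interpret prob_space "P i" by fact
      have int: "integrable (P i) (\<lambda>x. f (y, x))" for y
        by (rule integrable_continuous_compact[OF cpt sect P])
      have "\<bar>\<integral>x. f (g i, x) - f (g0, x) \<partial>P i\<bar> \<le> e/2"
        using elim X0(3) int by (intro abs_expectation_le) (auto simp: dist_real_def)
      also have "\<dots> < e" using e by simp
      finally show ?case using int by simp
    qed
  qed
  ultimately show ?thesis
    using tendsto_add by fastforce
qed

lemma weakly_converges_const: "weakly_converges (\<lambda>_. P) P F"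
  by (simp add: weakly_converges_def)

lemma continuous_on_integral_pair:
  fixes f :: "'b::topological_space \<times> 'a::topological_space \<Rightarrow> real"
  assumes "compact (UNIV :: 'a set)" "continuous_on UNIV f" "prob_space P" "sets P = sets borel"
  shows "continuous_on UNIV (\<lambda>y. \<integral>x. f (y, x) \<partial>P)"
  unfolding continuous_on_def
  by (intro ballI weakly_converges_integral_pair assms weakly_converges_const tendsto_ident_at)

text \<open>Open sets form an intersection-stable generator. In a compact Hausdorff space with a
  countable basis each of them is a countable union of closed sets, so its indicator is a pointwise
  limit of Urysohn functions and dominated convergence applies.\<close>

lemma borel_measure_eqI_continuous:
  fixes P Q :: "'a::{t2_space, second_countable_topology} measure"
  assumes cpt: "compact (UNIV :: 'a set)"
    and P: "prob_space P" "sets P = sets borel" and Q: "prob_space Q" "sets Q = sets borel"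
    and eq: "\<And>f :: 'a \<Rightarrow> real. continuous_on UNIV f \<Longrightarrow> integral\<^sup>L P f = integral\<^sup>L Q f"
  shows "P = Q"
proof -
  interpret P: prob_space P by fact
  interpret Q: prob_space Q by fact
  have normal: "normal_space (euclidean :: 'a topology)"
  proof (rule compact_Hausdorff_or_regular_imp_normal_space)
    have "Hausdorff_space (euclidean :: 'a topology)"
      unfolding Hausdorff_space_def by (auto simp: disjnt_def) (metis hausdorff)
    then show "Hausdorff_space (euclidean :: 'a topology) \<or> regular_space (euclidean :: 'a topology)" ..
  qed (use cpt in \<open>simp add: compact_space_def\<close>)
  have meas: "measure P U = measure Q U" if U: "open U" for U
  proof -
    obtain B :: "'a set set" where B: "countable B" "topological_basis B"
      using ex_countable_basis by blast
    \<comment> \<open>By normality these closures exhaust \<open>U\<close>. The empty set is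
      adjoined so that the enumeration makes sense even when \<open>C\<close> is empty.\<close>
    define C where "C = {closure b | b. b \<in> B \<and> closure b \<subseteq> U}"
    have C: "countable (insert {} C)"
      using B(1) by (auto simp: C_def intro: countable_subset[of _ "closure ` B"])
    have CU: "\<Union>C = U"
    proof (intro equalityI subsetI)
      fix x assume x: "x \<in> U"
      have "disjnt {x} (- U)" using x by auto
      then obtain V W where VW: "open V" "open W" "x \<in> V" "- U \<subseteq> W" "disjnt V W"
        using normal U unfolding normal_space_def
        by (metis closed_Compl closed_closedin closed_singleton empty_subsetI insert_subset open_openin)
      obtain b where b: "b \<in> B" "x \<in> b" "b \<subseteq> V"
        using topological_basisE[OF B(2) VW(1,3)] by blast
      have "closure b \<subseteq> - W"
        using b VW by (intro closure_minimal) (auto simp: disjnt_def)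
      with VW(4) have "closure b \<subseteq> U" by blast
      with b(1) have "closure b \<in> C" by (auto simp: C_def)
      moreover have "x \<in> closure b" using b(2) closure_subset[of b] by blast
      ultimately show "x \<in> \<Union>C" by blast
    qed (auto simp: C_def)
    \<comment> \<open>Cumulative unions put each point of \<open>U\<close> into \<open>K n\<close>
      for all large \<open>n\<close>, which gives pointwise convergence of the Urysohn functions
      chosen below.\<close>
    define K where "K n = (\<Union>i\<le>n. from_nat_into (insert {} C) i)" for n
    have fn: "from_nat_into (insert {} C) i \<in> insert {} C" for i
      by (rule from_nat_into) auto
    have fn': "closed (from_nat_into (insert {} C) i)" "from_nat_into (insert {} C) i \<subseteq> U" for i
      using fn[of i] unfolding C_def by auto
    have Kcl: "closed (K n)" and KU: "K n \<subseteq> U" for n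
      using fn' unfolding K_def by (intro closed_UN UN_least; simp)+
    have "\<exists>f. continuous_on UNIV f \<and> (\<forall>x. f x \<in> {0..1::real}) \<and> (\<forall>x\<in>-U. f x = 0) \<and> (\<forall>x\<in>K n. f x = 1)" for n
    proof -
      have "disjnt (- U) (K n)" using KU[of n] by (auto simp: disjnt_def)
      then obtain f where f: "continuous_map euclidean (top_of_set {0..1::real}) f" "f ` (- U) \<subseteq> {0}" "f ` K n \<subseteq> {1}"
        using Urysohn_lemma[OF normal, of "- U" "K n" 0 1] U Kcl by (metis closed_Compl closed_closedin zero_le_one)
      from f(1) have "continuous_on UNIV f" "\<forall>x. f x \<in> {0..1}"
        by (auto simp: continuous_map_in_subtopology)
      with f(2,3) show ?thesis by (intro exI[of _ f]) auto
    qed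
    then obtain f :: "nat \<Rightarrow> 'a \<Rightarrow> real" where f: "\<And>n. continuous_on UNIV (f n)" "\<And>n x. f n x \<in> {0..1}"
        "\<And>n x. x \<notin> U \<Longrightarrow> f n x = 0" "\<And>n x. x \<in> K n \<Longrightarrow> f n x = 1"
      by (metis ComplI)
    have lim: "(\<lambda>n. f n x) \<longlonglongrightarrow> indicator U x" for x
    proof (cases "x \<in> U")
      case True
      then obtain c where c: "c \<in> C" "x \<in> c" using CU by auto
      then obtain i where i: "from_nat_into (insert {} C) i = c"
        using from_nat_into_surj[OF C, of c] by auto
      have "eventually (\<lambda>n. f n x = 1) sequentially"
        using eventually_ge_at_top[of i] by eventually_elim (use c i in \<open>auto intro!: f(4) simp: K_def\<close>)
      with True show ?thesis by (auto intro: tendsto_eventually)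
    next
      case False
      then show ?thesis using f(3) by simp
    qed
    have conv: "(\<lambda>n. integral\<^sup>L R (f n)) \<longlonglongrightarrow> measure R U" if R: "prob_space R" "sets R = sets borel" for R
    proof -
      interpret R: prob_space R by fact
      have "(\<lambda>n. integral\<^sup>L R (f n)) \<longlonglongrightarrow> integral\<^sup>L R (indicator U :: 'a \<Rightarrow> real)"
      proof (rule integral_dominated_convergence[where w="\<lambda>_. 1"])
        show "f n \<in> borel_measurable R" for n
          using borel_measurable_continuous_onI[OF f(1)] R(2) by (simp cong: measurable_cong_sets)
        show "(indicator U :: 'a \<Rightarrow> real) \<in> borel_measurable R"
          using U R(2) by (intro borel_measurable_indicator) auto
      qed (use f(2) lim in auto)
      moreover have "U \<inter> space R = U" using sets_eq_imp_space_eq[OF R(2)] by auto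
      ultimately show ?thesis by simp
    qed
    show ?thesis
      using conv[OF P] conv[OF Q] LIMSEQ_unique unfolding eq[OF f(1)] by blast
  qed
  show ?thesis
  proof (rule measure_eqI_generator_eq[where E="{S. open S}" and \<Omega>=UNIV and A="\<lambda>_. UNIV"])
    show "Int_stable {S::'a set. open S}" by (auto simp: Int_stable_def)
    show "sets P = sigma_sets UNIV {S. open S}" "sets Q = sigma_sets UNIV {S. open S}"
      using P Q by (simp_all add: borel_def)
  qed (use meas P.emeasure_eq_measure Q.emeasure_eq_measure in auto)
qed

lemma weakly_converges_unique:
  fixes Q Q' :: "'a::{t2_space, second_countable_topology} measure"
  assumes "compact (UNIV :: 'a set)" "weakly_converges P Q F" "weakly_converges P Q' F" "F \<noteq> bot"
    "prob_space Q" "sets Q = sets borel" "prob_space Q'" "sets Q' = sets borel"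
  shows "Q = Q'"
proof (rule borel_measure_eqI_continuous[OF assms(1,5-8)])
  fix f :: "'a \<Rightarrow> real" assume f: "continuous_on UNIV f"
  have b: "bounded (range f)" by (rule bounded_range_continuous[OF assms(1) f])
  show "integral\<^sup>L Q f = integral\<^sup>L Q' f"
    using tendsto_unique[OF assms(4)] assms(2,3) f b unfolding weakly_converges_def by blast
qed

text \<open>A continuous function on a compact space is uniformly close to a step function whose
  pieces are basis sets minus finite unions of basis sets. There are countably many such pieces, so
  almost sure convergence on each of them holds off a single null set.\<close>

lemma countable_weak_convergence_determining:
  assumes cpt: "compact (UNIV :: 'a::second_countable_topology set)"
  obtains \<A> :: "'a::second_countable_topology set set" where "countable \<A>" "\<A> \<subseteq> sets borel"
    "\<And>(P :: 'i \<Rightarrow> 'a::second_countable_topology measure) Q F. \<lbrakk>\<And>i. prob_space (P i); \<And>i. sets (P i) = sets borel;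
       prob_space Q; sets Q = sets borel;
       \<And>A. A \<in> \<A> \<Longrightarrow> ((\<lambda>i. measure (P i) A) \<longlongrightarrow> measure Q A) F\<rbrakk> \<Longrightarrow> weakly_converges P Q F"
proof -
  obtain B :: "'a set set" where B: "countable B" "topological_basis B"
    using ex_countable_basis by blast
  have opB: "open b" if "b \<in> B" for b using topological_basis_open[OF B(2) that] .
  \<comment> \<open>Exactly the shape of the pieces obtained by making a finite list of basis sets
    disjoint.\<close>
  define \<A> where "\<A> = (\<lambda>(b, T). b - \<Union>T) ` (B \<times> {T. finite T \<and> T \<subseteq> B})"
  have "countable \<A>"
    using B(1) by (auto simp: \<A>_def intro!: countable_image countable_SIGMA countable_Collect_finite_subset)
  moreover have sets: "\<A> \<subseteq> sets borel"
    using opB by (auto simp: \<A>_def intro!: sets.Diff[OF borel_open borel_open] open_Union)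
  moreover have "weakly_converges P Q F"
    if P: "\<And>i. prob_space (P i)" "\<And>i. sets (P i) = sets borel" "prob_space Q" "sets Q = sets borel"
      and lim: "\<And>A. A \<in> \<A> \<Longrightarrow> ((\<lambda>i. measure (P i) A) \<longlongrightarrow> measure Q A) F"
    for P :: "'i \<Rightarrow> 'a measure" and Q F
    unfolding weakly_converges_def
  proof (intro allI impI tendstoI)
    fix f :: "'a \<Rightarrow> real" and e :: real
    assume f: "continuous_on UNIV f \<and> bounded (range f)" and e: "e > 0"
    \<comment> \<open>One third of \<open>e\<close> is spent on the step approximation under
      \<open>P i\<close>, one third under \<open>Q\<close>, and one third on the convergence of the
      step integrals.\<close>
    define C where "C = {b \<in> B. \<forall>x\<in>b. \<forall>y\<in>b. dist (f x) (f y) < e/3}"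
    have "UNIV \<subseteq> \<Union>C"
    proof
      fix x
      have "open (f -` ball (f x) (e/6))"
        using f by (intro open_vimage) auto
      then obtain b where b: "b \<in> B" "x \<in> b" "b \<subseteq> f -` ball (f x) (e/6)"
        using topological_basisE[OF B(2), of "f -` ball (f x) (e/6)" x] e by auto
      have "dist (f y) (f z) < e/3" if "y \<in> b" "z \<in> b" for y z
      proof -
        have "dist (f x) (f y) < e/6" "dist (f x) (f z) < e/6" using b that by auto
        then show ?thesis unfolding dist_real_def by linarith
      qed
      with b show "x \<in> \<Union>C" by (auto simp: C_def)
    qed
    moreover have "\<And>b. b \<in> C \<Longrightarrow> open b" using opB by (auto simp: C_def)
    ultimately obtain D where D: "D \<subseteq> C" "finite D" "UNIV \<subseteq> \<Union>D"
      using compactE[OF cpt] by metis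
    obtain b :: "nat \<Rightarrow> 'a set" and n where b: "D = b ` {i. i < n}"
      using D(2) by (metis finite_imp_nat_seg_image_inj_on)
    have bC: "b i \<in> C" if "i < n" for i using D(1) that unfolding b by auto
    \<comment> \<open>If \<open>b i\<close> is empty, \<open>x i\<close> is arbitrary; this is
      harmless, since the corresponding disjoint piece is then empty too.\<close>
    define x where "x i = (SOME x. x \<in> b i)" for i
    have dA: "disjointed b i \<in> \<A>" if "i < n" for i
    proof -
      have "b j \<in> B" if "j < n" for j using bC[OF that] by (simp add: C_def)
      with that have "(b i, b ` {0..<i}) \<in> B \<times> {T. finite T \<and> T \<subseteq> B}" by auto
      then show ?thesis unfolding \<A>_def by (rule rev_image_eqI) (simp add: disjointed_def)
    qed
    define s where "s y = (\<Sum>i<n. f (x i) * indicator (disjointed b i) y)" for y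
    have near: "\<bar>f y - s y\<bar> \<le> e/3" for y
    proof -
      have "y \<in> (\<Union>i\<in>{0..<n}. b i)" using D(3) unfolding b by (auto simp: atLeast0LessThan lessThan_def)
      then have "y \<in> (\<Union>i\<in>{0..<n}. disjointed b i)" by (simp add: finite_UN_disjointed_eq)
      then obtain i where i: "i < n" "y \<in> disjointed b i" by auto
      have "indicator (disjointed b j) y = (if j = i then 1 else 0::real)" for j
        using i(2) disjoint_family_disjointed[of b] by (auto simp: disjoint_family_on_def indicator_def)
      then have "s y = (\<Sum>j<n. if j = i then f (x j) else 0)"
        unfolding s_def by (intro sum.cong) simp_all
      then have sy: "s y = f (x i)" using i(1) by simp
      have yb: "y \<in> b i" using i(2) disjointed_subset[of b i] by auto
      then have "x i \<in> b i" unfolding x_def by (rule someI)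
      with bC[OF i(1)] yb have "dist (f y) (f (x i)) < e/3" by (auto simp: C_def)
      with sy show ?thesis by (simp add: dist_real_def)
    qed
    have s_int: "integral\<^sup>L R s = (\<Sum>i<n. f (x i) * measure R (disjointed b i))"
      and s_near: "\<bar>integral\<^sup>L R f - integral\<^sup>L R s\<bar> \<le> e/3"
      if R: "prob_space R" "sets R = sets borel" for R
    proof -
      interpret R: prob_space R by fact
      have sR: "space R = UNIV" using sets_eq_imp_space_eq[OF R(2)] by simp
      have dR: "disjointed b i \<in> sets R" if "i < n" for i
        using subsetD[OF sets dA[OF that]] R(2) by simp
      have int: "integrable R (\<lambda>y. f (x i) * indicator (disjointed b i) y)" if "i < n" for i
        using dR[OF that] by (intro integrable_mult_right integrable_real_indicator) (simp_all add: R.emeasure_eq_measure)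
      then have ints: "integrable R s" unfolding s_def by (intro Bochner_Integration.integrable_sum) auto
      show "integral\<^sup>L R s = (\<Sum>i<n. f (x i) * measure R (disjointed b i))"
        unfolding s_def using int by (subst Bochner_Integration.integral_sum) (auto simp: sR)
      have intf: "integrable R f" using cpt f R by (intro integrable_continuous_compact) auto
      have "\<bar>\<integral>y. f y - s y \<partial>R\<bar> \<le> e/3"
        using near ints intf by (intro R.abs_expectation_le) auto
      then show "\<bar>integral\<^sup>L R f - integral\<^sup>L R s\<bar> \<le> e/3"
        using ints intf by simp
    qed
    have "((\<lambda>i. integral\<^sup>L (P i) s) \<longlongrightarrow> integral\<^sup>L Q s) F"
      unfolding s_int[OF P(1,2)] s_int[OF P(3,4)] by (intro tendsto_sum tendsto_mult tendsto_const lim dA) simp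
    then have "eventually (\<lambda>i. dist (integral\<^sup>L (P i) s) (integral\<^sup>L Q s) < e/3) F"
      using e by (intro tendstoD) auto
    then show "eventually (\<lambda>i. dist (integral\<^sup>L (P i) f) (integral\<^sup>L Q f) < e) F"
    proof eventually_elim
      case (elim i)
      then show ?case using s_near[OF P(1,2), of i] s_near[OF P(3,4)] unfolding dist_real_def by linarith
    qed
  qed
  ultimately show thesis by (rule that)
qed

section \<open>Backward martingales with trivial tail\<close>

text \<open>
  A maximal inequality suffices: if \<open>X n > a\<close> for infinitely many \<open>n\<close> almost surely, then
  stopping at the largest such \<open>n \<le> N\<close> (the earliest one, since \<open>F\<close> is decreasing) gives \<open>P(A) \<ge> a\<close>.
\<close>

lemma (in prob_space) backward_martingale_upper:
  assumes F: "\<And>n. sigma_algebra (space M) (F n)" "\<And>n. F n \<subseteq> events" "decseq F"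
    and trivial: "\<And>T. (\<And>n. T \<in> F n) \<Longrightarrow> prob T = 0 \<or> prob T = 1"
    and A: "A \<in> events"
    and X: "\<And>n a. {\<omega> \<in> space M. X n \<omega> > a} \<in> F n" "\<And>n. integrable M (X n)"
    and version: "\<And>n B. B \<in> F n \<Longrightarrow> prob (A \<inter> B) = (\<integral>\<omega>. indicator B \<omega> * X n \<omega> \<partial>M)"
    and a: "a > prob A"
  shows "AE \<omega> in M. \<forall>\<^sub>F n in sequentially. X n \<omega> \<le> a"
proof -
  define E where "E n = {\<omega> \<in> space M. X n \<omega> > a}" for n
  define T where "T = (\<Inter>m. \<Union>n\<in>{m..}. E n)"
  have mono: "F n \<subseteq> F m" if "m \<le> n" for m n
    using F(3) that by (auto simp: decseq_def)
  have E: "E n \<in> F n" for n using X(1) by (simp add: E_def)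
  \<comment> \<open>The upper limit of the events \<open>E n\<close> ignores the first
    \<open>k\<close> of them, and the later ones all lie in \<open>F k\<close>; so \<open>T\<close>
    is a tail event.\<close>
  have T_shift: "T = (\<Inter>m\<in>{k..}. \<Union>n\<in>{m..}. E n)" for k
  proof (intro equalityI subsetI)
    fix \<omega> assume \<omega>: "\<omega> \<in> (\<Inter>m\<in>{k..}. \<Union>n\<in>{m..}. E n)"
    show "\<omega> \<in> T" unfolding T_def
    proof (intro INT_I)
      fix m
      have "\<omega> \<in> (\<Union>n\<in>{max m k..}. E n)" using \<omega> by auto
      then show "\<omega> \<in> (\<Union>n\<in>{m..}. E n)" by auto
    qed
  qed (auto simp: T_def)
  have T: "T \<in> F k" for k
  proof -
    interpret sigma_algebra "space M" "F k" by (rule F)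
    have "E n \<in> F k" if "k \<le> n" for n using E[of n] mono[OF that] by blast
    then have "(\<Union>n\<in>{m..}. E n) \<in> F k" if "k \<le> m" for m
      using that by (intro countable_UN'') auto
    then show ?thesis unfolding T_shift[of k]
      by (intro countable_INT') auto
  qed
  have Eev: "E n \<in> events" for n using E F(2) by auto
  have "prob T \<noteq> 1"
  proof
    assume T1: "prob T = 1"
    have bound: "a * prob (\<Union>n\<in>{..N}. E n) \<le> prob A" for N
    proof -
      \<comment> \<open>The event that \<open>n\<close> is the last index up to \<open>N\<close>
        with \<open>X n\<close> above \<open>a\<close>. It refers to larger indices only, whose
        sigma-algebras are contained in \<open>F n\<close>; hence \<open>version\<close> applies to
        it.\<close>
      define D where "D n = E n - (\<Union>i\<in>{n<..N}. E i)" for n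
      have D: "D n \<in> F n" for n
      proof -
        interpret sigma_algebra "space M" "F n" by (rule F)
        show ?thesis unfolding D_def
          using E mono[of n] by (intro Diff finite_UN) (auto dest: less_imp_le)
      qed
      then have Dev: "D n \<in> events" for n using F(2) by auto
      have disj: "disjoint_family_on D {..N}"
        by (auto simp: disjoint_family_on_def D_def) (metis greaterThanAtMost_iff nat_neq_iff)+
      have un: "(\<Union>n\<in>{..N}. E n) = (\<Union>n\<in>{..N}. D n)"
      proof (intro equalityI subsetI)
        fix \<omega> assume "\<omega> \<in> (\<Union>n\<in>{..N}. E n)"
        then have ne: "{n. n \<le> N \<and> \<omega> \<in> E n} \<noteq> {}" by auto
        define k where "k = Max {n. n \<le> N \<and> \<omega> \<in> E n}"
        have "k \<in> {n. n \<le> N \<and> \<omega> \<in> E n}" unfolding k_def by (rule Max_in) (use ne in auto)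
        moreover have "i \<le> k" if "i \<le> N" "\<omega> \<in> E i" for i
          unfolding k_def by (rule Max_ge) (use that in auto)
        ultimately show "\<omega> \<in> (\<Union>n\<in>{..N}. D n)" by (fastforce simp: D_def)
      qed (auto simp: D_def)
      have "a * prob (D n) \<le> prob (A \<inter> D n)" for n
      proof -
        have int: "integrable M (\<lambda>\<omega>. indicator (D n) \<omega> * X n \<omega>)"
          using integrable_mult_indicator[OF Dev X(2)] by simp
        have "a * prob (D n) = (\<integral>\<omega>. indicator (D n) \<omega> * a \<partial>M)"
          using Dev sets.sets_into_space[OF Dev] by (simp add: Int_absorb2 mult.commute)
        also have "\<dots> \<le> (\<integral>\<omega>. indicator (D n) \<omega> * X n \<omega> \<partial>M)"
          using Dev int
          by (intro integral_mono integrable_mult_left integrable_real_indicator)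
             (auto simp: emeasure_eq_measure indicator_def D_def E_def)
        finally show ?thesis using version[OF D] by simp
      qed
      then have "(\<Sum>n\<le>N. a * prob (D n)) \<le> (\<Sum>n\<le>N. prob (A \<inter> D n))" by (intro sum_mono) auto
      also have "\<dots> = prob (\<Union>n\<in>{..N}. A \<inter> D n)"
        using disj Dev A
        by (intro finite_measure_finite_Union[symmetric]) (auto simp: disjoint_family_on_def)
      also have "\<dots> \<le> prob A" using A by (intro finite_measure_mono) auto
      also have "(\<Sum>n\<le>N. a * prob (D n)) = a * prob (\<Union>n\<in>{..N}. D n)"
        using disj Dev by (subst finite_measure_finite_Union) (auto simp: sum_distrib_left)
      finally show ?thesis unfolding un .
    qed
    \<comment> \<open>If \<open>T\<close> had probability 1, these unions would have probabilities
      tending to 1, and \<open>bound\<close> would give \<open>a \<le> prob A\<close>.\<close>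
    have "(\<lambda>N. prob (\<Union>n\<in>{..N}. E n)) \<longlonglongrightarrow> prob (\<Union>N. \<Union>n\<in>{..N}. E n)"
      using Eev by (intro finite_Lim_measure_incseq) (auto simp: incseq_def, fastforce)
    moreover have "T \<subseteq> (\<Union>N. \<Union>n\<in>{..N}. E n)" by (auto simp: T_def)
    then have "prob T \<le> prob (\<Union>N. \<Union>n\<in>{..N}. E n)"
      using Eev by (intro finite_measure_mono) auto
    then have "prob (\<Union>N. \<Union>n\<in>{..N}. E n) = 1" using T1 prob_le_1 by (metis dual_order.antisym)
    ultimately have "(\<lambda>N. a * prob (\<Union>n\<in>{..N}. E n)) \<longlonglongrightarrow> a * 1"
      by (intro tendsto_mult) auto
    then have "a * 1 \<le> prob A" by (rule LIMSEQ_le_const2) (use bound in auto)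
    with a show False by simp
  qed
  with trivial T have "prob T = 0" by blast
  moreover have "T \<in> events" using T F(2) by auto
  ultimately have "AE \<omega> in M. \<omega> \<notin> T"
    using prob_eq_0 by blast
  then show ?thesis
    using AE_space by eventually_elim
      (auto simp: T_def E_def eventually_sequentially not_less)
qed

text \<open>The one-sided estimate is applied to \<open>A\<close> with \<open>X n\<close>, and to
  the complement of \<open>A\<close> with \<open>1 - X n\<close>. Together they squeeze
  \<open>X n\<close> around \<open>prob A\<close>, up to margins \<open>1 / Suc j\<close> that form
  a countable family.\<close>

lemma (in prob_space) backward_martingale_convergence:
  assumes F: "\<And>n. sigma_algebra (space M) (F n)" "\<And>n. F n \<subseteq> events" "decseq F"
    and trivial: "\<And>T. (\<And>n. T \<in> F n) \<Longrightarrow> prob T = 0 \<or> prob T = 1"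
    and A: "A \<in> events"
    and X: "\<And>n. X n \<in> borel_measurable (sigma (space M) (F n))" "\<And>n. integrable M (X n)"
    and version: "\<And>n B. B \<in> F n \<Longrightarrow> prob (A \<inter> B) = (\<integral>\<omega>. indicator B \<omega> * X n \<omega> \<partial>M)"
  shows "AE \<omega> in M. (\<lambda>n. X n \<omega>) \<longlonglongrightarrow> prob A"
proof -
  have sF: "sets (sigma (space M) (F n)) = F n" "space (sigma (space M) (F n)) = space M" for n
    using sigma_algebra.sets_measure_of_eq[OF F(1)] sigma_algebra.space_measure_of_eq[OF F(1)] by auto
  have up: "AE \<omega> in M. \<forall>\<^sub>F n in sequentially. X n \<omega> \<le> prob A + 1 / Suc j" for j :: nat
  proof (rule backward_martingale_upper[OF F trivial A _ X(2) version])
    fix n a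
    show "{\<omega> \<in> space M. X n \<omega> > a} \<in> F n"
      using measurable_sets[OF X(1), of "{a<..}" n] by (simp add: sF vimage_def Int_def conj_commute)
  qed auto
  have low: "AE \<omega> in M. \<forall>\<^sub>F n in sequentially. 1 - X n \<omega> \<le> prob (space M - A) + 1 / Suc j" for j :: nat
  proof (rule backward_martingale_upper[OF F trivial])
    fix n a
    show "{\<omega> \<in> space M. 1 - X n \<omega> > a} \<in> F n"
      using measurable_sets[OF X(1), of "{..<1 - a}" n]
      by (simp add: sF vimage_def Int_def conj_commute less_diff_eq add.commute)
  next
    fix n B assume B: "B \<in> F n"
    then have Bev: "B \<in> events" using F(2) by auto
    have "(\<integral>\<omega>. indicator B \<omega> * (1 - X n \<omega>) \<partial>M) = (\<integral>\<omega>. indicator B \<omega> - indicator B \<omega> * X n \<omega> \<partial>M)"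
      by (simp add: algebra_simps)
    also have "\<dots> = prob B - prob (A \<inter> B)"
      using Bev sets.sets_into_space[OF Bev] integrable_mult_indicator[OF Bev X(2)]
      by (subst Bochner_Integration.integral_diff) (auto simp: version[OF B] Int_absorb2 emeasure_eq_measure)
    also have "\<dots> = prob ((space M - A) \<inter> B)"
    proof -
      have "(space M - A) \<inter> B = B - A \<inter> B" using sets.sets_into_space[OF Bev] by auto
      then show ?thesis using A Bev finite_measure_Diff[of B "A \<inter> B"] by auto
    qed
    finally show "prob ((space M - A) \<inter> B) = (\<integral>\<omega>. indicator B \<omega> * (1 - X n \<omega>) \<partial>M)" by simp
  qed (use A X(2) in auto)
  have "AE \<omega> in M. \<forall>j. (\<forall>\<^sub>F n in sequentially. X n \<omega> \<le> prob A + 1 / Suc j) \<and>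
      (\<forall>\<^sub>F n in sequentially. 1 - X n \<omega> \<le> prob (space M - A) + 1 / Suc j)"
    using up low by (simp add: AE_all_countable)
  then show ?thesis
  proof eventually_elim
    case (elim \<omega>)
    show ?case
    proof (rule tendstoI)
      fix e :: real assume "e > 0"
      then obtain j :: nat where j: "1 / Suc j < e"
        using nat_approx_posE by blast
      have "\<forall>\<^sub>F n in sequentially. X n \<omega> \<le> prob A + 1 / Suc j"
        "\<forall>\<^sub>F n in sequentially. 1 - X n \<omega> \<le> prob (space M - A) + 1 / Suc j"
        using elim by auto
      then show "\<forall>\<^sub>F n in sequentially. dist (X n \<omega>) (prob A) < e"
        by eventually_elim (use j prob_compl[OF A] in \<open>auto simp: dist_real_def\<close>)
    qed
  qed
qed

section \<open>Solutions as Markov chains\<close>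

lemma sigma_algebra_past_events: "sigma_algebra (space M) (past_events M \<eta> j)"
  unfolding past_events_def by (rule sigma_algebra_sigma_sets) auto

lemma sets_sigma_past_events [simp]:
  "sets (sigma (space M) (past_events M \<eta> j)) = past_events M \<eta> j"
  using sigma_algebra.sets_measure_of_eq[OF sigma_algebra_past_events] .

lemma past_events_mono: "i \<le> j \<Longrightarrow> past_events M \<eta> i \<subseteq> past_events M \<eta> j"
  unfolding past_events_def by (rule sigma_sets_subseteq) force

lemma measurable_past_events:
  fixes \<eta> :: "int \<Rightarrow> 'w \<Rightarrow> 'a::topological_space"
  assumes "m \<le> j"
  shows "\<eta> m \<in> borel_measurable (sigma (space M) (past_events M \<eta> j))"
proof (rule measurableI)
  fix A :: "'a set" assume "A \<in> sets borel"
  then show "\<eta> m -` A \<inter> space (sigma (space M) (past_events M \<eta> j)) \<in> sets (sigma (space M) (past_events M \<eta> j))"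
    using assms unfolding sets_sigma_past_events
    by (auto simp: past_events_def space_measure_of_conv intro!: sigma_sets.Basic)
qed simp

context
  fixes \<mu> :: "int \<Rightarrow> 'a::{topological_group_add, t2_space, second_countable_topology} measure"
    and M :: "'w measure" and \<eta> \<xi>
  assumes sol: "solution \<mu> M \<eta> \<xi>"
begin

lemma solution_prob_space: "prob_space M"
  and solution_measurable: "k \<le> 0 \<Longrightarrow> \<eta> k \<in> borel_measurable M" "k \<le> 0 \<Longrightarrow> \<xi> k \<in> borel_measurable M"
  and solution_AE: "k \<le> 0 \<Longrightarrow> AE \<omega> in M. \<eta> k \<omega> = \<xi> k \<omega> + \<eta> (k - 1) \<omega>"
  and solution_indep: "k \<le> 0 \<Longrightarrow>
    prob_space.indep_set M {\<xi> k -` A \<inter> space M | A. A \<in> sets borel} (past_events M \<eta> (k - 1))"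
  and solution_law: "k \<le> 0 \<Longrightarrow> distr M borel (\<xi> k) = \<mu> k"
  using sol by (auto simp: solution_def)

lemma past_events_subset: "j \<le> 0 \<Longrightarrow> past_events M \<eta> j \<subseteq> sets M"
  unfolding past_events_def
  by (intro sets.sigma_sets_subset) (auto intro!: measurable_sets solution_measurable)

lemma solution_noise_law: "k \<le> 0 \<Longrightarrow> prob_space (\<mu> k)" "k \<le> 0 \<Longrightarrow> sets (\<mu> k) = sets borel"
  using prob_space.prob_space_distr[OF solution_prob_space solution_measurable(2)]
  by (auto simp flip: solution_law)

end

text \<open>The identity map is treated as a random variable with values in the space equipped with
  the coarser sigma-algebra \<open>F\<close>. Independence says that the joint law of
  \<open>X\<close> and this map is a product measure, and Tonelli's theorem does the rest.\<close>

lemma (in prob_space) nn_integral_indep_freeze: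
  fixes X :: "'a \<Rightarrow> 'b::topological_space"
  assumes X[measurable]: "X \<in> borel_measurable M"
    and F: "sigma_algebra (space M) F" "F \<subseteq> events"
    and ind: "indep_set {X -` A \<inter> space M | A. A \<in> sets borel} F"
    and h: "h \<in> borel_measurable (borel \<Otimes>\<^sub>M sigma (space M) F)"
  shows "(\<integral>\<^sup>+\<omega>. h (X \<omega>, \<omega>) \<partial>M) = (\<integral>\<^sup>+\<omega>. \<integral>\<^sup>+x. h (x, \<omega>) \<partial>distr M borel X \<partial>M)"
proof -
  define N where "N = sigma (space M) F"
  have sN: "sets N = F" and spN: "space N = space M"
    using sigma_algebra.sets_measure_of_eq[OF F(1)] by (auto simp: N_def space_measure_of_conv)
  have id: "(\<lambda>\<omega>. \<omega>) \<in> measurable M N"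
    using F(2) by (intro measurableI) (auto simp: sN spN)
  have pm: "(\<lambda>\<omega>. (X \<omega>, \<omega>)) \<in> measurable M (borel \<Otimes>\<^sub>M N)"
    by (intro measurable_Pair X id)
  let ?L = "distr M borel X" and ?N = "distr M N (\<lambda>\<omega>. \<omega>)"
  interpret L: prob_space ?L by (rule prob_space_distr[OF X])
  interpret N': prob_space ?N by (rule prob_space_distr[OF id])
  interpret LN: pair_prob_space ?L ?N ..
  have eq: "?L \<Otimes>\<^sub>M ?N = distr M (borel \<Otimes>\<^sub>M N) (\<lambda>\<omega>. (X \<omega>, \<omega>))"
  proof (rule pair_measure_eqI)
    show "sets (?L \<Otimes>\<^sub>M ?N) = sets (distr M (borel \<Otimes>\<^sub>M N) (\<lambda>\<omega>. (X \<omega>, \<omega>)))"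
      by (simp cong: sets_pair_measure_cong)
    fix A B assume "A \<in> sets ?L" "B \<in> sets ?N"
    then have A: "A \<in> sets borel" and B: "B \<in> F" by (simp_all add: sN)
    have Bev: "B \<in> events" using B F(2) by auto
    have pre: "(\<lambda>\<omega>. (X \<omega>, \<omega>)) -` (A \<times> B) \<inter> space M = (X -` A \<inter> space M) \<inter> B"
      using sets.sets_into_space[OF Bev] by auto
    have "emeasure (distr M (borel \<Otimes>\<^sub>M N) (\<lambda>\<omega>. (X \<omega>, \<omega>))) (A \<times> B) = emeasure M ((X -` A \<inter> space M) \<inter> B)"
      using A B pm by (subst emeasure_distr) (auto simp: sN pre)
    also have "\<dots> = ennreal (prob (X -` A \<inter> space M) * prob B)"
      using indep_setD[OF ind, of "X -` A \<inter> space M" B] A B by (auto simp: emeasure_eq_measure)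
    also have "\<dots> = emeasure ?L A * emeasure ?N B"
      using A B id Bev sets.sets_into_space[OF Bev]
      by (simp add: emeasure_distr sN emeasure_eq_measure ennreal_mult Int_absorb2)
    finally show "emeasure ?L A * emeasure ?N B = emeasure (distr M (borel \<Otimes>\<^sub>M N) (\<lambda>\<omega>. (X \<omega>, \<omega>))) (A \<times> B)" ..
  qed unfold_locales
  have h': "h \<in> borel_measurable (borel \<Otimes>\<^sub>M N)" using h by (simp add: N_def)
  have h'': "h \<in> borel_measurable (?L \<Otimes>\<^sub>M ?N)"
    using h' by (simp cong: measurable_cong_sets sets_pair_measure_cong)
  have "(\<integral>\<^sup>+\<omega>. h (X \<omega>, \<omega>) \<partial>M) = (\<integral>\<^sup>+z. h z \<partial>(?L \<Otimes>\<^sub>M ?N))"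
    unfolding eq using pm h' by (subst nn_integral_distr) auto
  also have "\<dots> = (\<integral>\<^sup>+\<omega>. \<integral>\<^sup>+x. h (x, \<omega>) \<partial>?L \<partial>?N)"
    using LN.nn_integral_snd[OF h''] by simp
  also have "\<dots> = (\<integral>\<^sup>+\<omega>. \<integral>\<^sup>+x. h (x, \<omega>) \<partial>?L \<partial>M)"
  proof -
    have "(\<lambda>z. h (snd z, fst z)) \<in> borel_measurable (N \<Otimes>\<^sub>M borel)"
      using measurable_compose[OF measurable_pair_swap' h'] by (simp add: split_beta')
    then have "(\<lambda>z. h (snd z, fst z)) \<in> borel_measurable (N \<Otimes>\<^sub>M ?L)"
      by (simp cong: measurable_cong_sets sets_pair_measure_cong)
    then have "(\<lambda>\<omega>. \<integral>\<^sup>+x. h (x, \<omega>) \<partial>?L) \<in> borel_measurable N"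
      using L.borel_measurable_nn_integral[of "\<lambda>\<omega> x. h (x, \<omega>)" N] by (simp add: split_beta')
    then show ?thesis by (intro nn_integral_distr[OF id]) simp
  qed
  finally show ?thesis .
qed

lemma borel_measurable_nn_integral_translate:
  fixes f :: "'a::{topological_group_add, t2_space, second_countable_topology} \<Rightarrow> ennreal"
  assumes "prob_space P" "sets P = sets borel" "f \<in> borel_measurable borel"
  shows "(\<lambda>y. \<integral>\<^sup>+x. f (x + y) \<partial>P) \<in> borel_measurable borel"
proof -
  interpret prob_space P by fact
  have "(\<lambda>z. f (snd z + fst z)) \<in> borel_measurable (borel \<Otimes>\<^sub>M P)"
    using assms(2,3) by (intro measurable_compose[OF _ assms(3)] borel_measurable_add)
      (simp_all cong: measurable_cong_sets sets_pair_measure_cong)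
  then show ?thesis
    using borel_measurable_nn_integral[of "\<lambda>y x. f (x + y)" borel] by (simp add: split_beta')
qed

section \<open>Noise products and the Markov property\<close>

lemma noise_product_empty: "k < l \<Longrightarrow> noise_product \<xi> k l \<omega> = 0"
  by (simp add: noise_product_def)

lemma noise_product_rec: "l \<le> k \<Longrightarrow> noise_product \<xi> k l \<omega> = \<xi> k \<omega> + noise_product \<xi> (k - 1) l \<omega>"
  by (simp add: noise_product_def upto_rec2)

context
  fixes \<mu> :: "int \<Rightarrow> 'a::{topological_group_add, t2_space, second_countable_topology} measure"
    and M :: "'w measure" and \<eta> \<xi>
  assumes sol: "solution \<mu> M \<eta> \<xi>"
begin

lemma measurable_noise_product:
  assumes "k \<le> 0"
  shows "noise_product \<xi> k l \<in> borel_measurable M"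
proof (cases "l \<le> k + 1")
  case True
  then have "l - 1 \<le> k" by simp
  then have "k \<le> 0 \<longrightarrow> noise_product \<xi> k l \<in> borel_measurable M"
  proof (induction k rule: int_ge_induct)
    case base
    have "noise_product \<xi> (l - 1) l = (\<lambda>_. 0)" by (auto simp: noise_product_empty)
    then show ?case by simp
  next
    case (step k)
    then have "noise_product \<xi> (k + 1) l = (\<lambda>\<omega>. \<xi> (k + 1) \<omega> + noise_product \<xi> k l \<omega>)"
      by (auto simp: noise_product_rec)
    with step show ?case
      using solution_measurable(2)[OF sol, of "k + 1"] by (auto intro!: borel_measurable_add)
  qed
  with assms show ?thesis by simp
next
  case False
  then have "noise_product \<xi> k l = (\<lambda>_. 0)" by (auto simp: noise_product_empty)
  then show ?thesis by simp
qed

text \<open>The one-step transition: given the past, the noise \<open>\<xi> k\<close> is integrated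
  out against \<open>\<mu> k\<close>. \<open>Y\<close> may be any variable measurable with respect
  to the past, because it is also needed for differences of values of \<open>\<eta>\<close>.\<close>

lemma solution_freeze:
  assumes k: "k \<le> 0" and B: "B \<in> past_events M \<eta> (k - 1)"
    and Y: "Y \<in> borel_measurable (sigma (space M) (past_events M \<eta> (k - 1)))"
    and f: "f \<in> borel_measurable borel"
  shows "(\<integral>\<^sup>+\<omega>. indicator B \<omega> * f (\<xi> k \<omega> + Y \<omega>) \<partial>M) =
    (\<integral>\<^sup>+\<omega>. indicator B \<omega> * (\<integral>\<^sup>+x. f (x + Y \<omega>) \<partial>\<mu> k) \<partial>M)"
proof -
  let ?N = "sigma (space M) (past_events M \<eta> (k - 1))"
  interpret prob_space M by (rule solution_prob_space[OF sol])
  have [measurable]: "B \<in> sets ?N" using B by simp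
  note Y[measurable] f[measurable]
  have "(\<integral>\<^sup>+\<omega>. indicator B \<omega> * f (\<xi> k \<omega> + Y \<omega>) \<partial>M) =
    (\<integral>\<^sup>+\<omega>. \<integral>\<^sup>+x. indicator B \<omega> * f (x + Y \<omega>) \<partial>\<mu> k \<partial>M)"
  proof -
    have "(\<lambda>z. indicator B (snd z) * f (fst z + Y (snd z))) \<in> borel_measurable (borel \<Otimes>\<^sub>M ?N)"
      by measurable
    from nn_integral_indep_freeze[OF solution_measurable(2)[OF sol k] sigma_algebra_past_events
        past_events_subset[OF sol] solution_indep[OF sol k] this] k
    show ?thesis by (simp add: solution_law[OF sol k])
  qed
  also have "\<dots> = (\<integral>\<^sup>+\<omega>. indicator B \<omega> * (\<integral>\<^sup>+x. f (x + Y \<omega>) \<partial>\<mu> k) \<partial>M)"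
  proof (intro nn_integral_cong nn_integral_cmult)
    fix \<omega>
    have "(\<lambda>x. f (x + Y \<omega>)) \<in> borel_measurable borel" by measurable
    then show "(\<lambda>x. f (x + Y \<omega>)) \<in> borel_measurable (\<mu> k)"
      using solution_noise_law(2)[OF sol k] by (simp cong: measurable_cong_sets)
  qed
  finally show ?thesis .
qed

text \<open>The recursion telescopes; \<open>l = k + 1\<close> gives the empty product. The identity
  makes earlier noise products functions of the past of \<open>\<eta>\<close>, up to a null set, and
  so provides the independence from \<open>\<xi> k\<close> that the definition of a solution does
  not state directly.\<close>

lemma noise_product_eq_diff:
  assumes "k \<le> 0" "l \<le> k + 1"
  shows "AE \<omega> in M. noise_product \<xi> k l \<omega> = \<eta> k \<omega> - \<eta> (l - 1) \<omega>"
proof -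
  have "l - 1 \<le> k" using assms by simp
  then have "k \<le> 0 \<longrightarrow> (AE \<omega> in M. noise_product \<xi> k l \<omega> = \<eta> k \<omega> - \<eta> (l - 1) \<omega>)"
  proof (induction k rule: int_ge_induct)
    case base
    then show ?case by (simp add: noise_product_empty)
  next
    case (step k)
    show ?case
    proof
      assume k: "k + 1 \<le> 0"
      have "AE \<omega> in M. noise_product \<xi> k l \<omega> = \<eta> k \<omega> - \<eta> (l - 1) \<omega>" using step k by simp
      moreover have "AE \<omega> in M. \<eta> (k + 1) \<omega> = \<xi> (k + 1) \<omega> + \<eta> k \<omega>"
        using solution_AE[OF sol k] by simp
      ultimately show "AE \<omega> in M. noise_product \<xi> (k + 1) l \<omega> = \<eta> (k + 1) \<omega> - \<eta> (l - 1) \<omega>"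
        by eventually_elim (use step noise_product_rec[of l "k + 1" \<xi>] in \<open>simp add: add_diff_eq\<close>)
    qed
  qed
  with assms show ?thesis by simp
qed

text \<open>The factor \<open>noise_product \<xi> (k - 1) l\<close> is replaced by its telescoped
  form, to which \<open>solution_freeze\<close> applies with the whole space as
  \<open>B\<close>.\<close>

lemma nn_integral_noise_product_rec:
  assumes k: "k \<le> 0" and l: "l \<le> k" and f: "f \<in> borel_measurable borel"
  shows "(\<integral>\<^sup>+\<omega>. f (noise_product \<xi> k l \<omega> + y) \<partial>M) =
    (\<integral>\<^sup>+\<omega>. (\<integral>\<^sup>+x. f (x + (noise_product \<xi> (k - 1) l \<omega> + y)) \<partial>\<mu> k) \<partial>M)"
proof -
  let ?N = "sigma (space M) (past_events M \<eta> (k - 1))"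
  let ?Y = "\<lambda>\<omega>. \<eta> (k - 1) \<omega> + - \<eta> (l - 1) \<omega> + y"
  interpret prob_space M by (rule solution_prob_space[OF sol])
  have B: "space M \<in> past_events M \<eta> (k - 1)"
    using sets.top[of ?N] by (simp add: space_measure_of_conv)
  have Y: "?Y \<in> borel_measurable ?N"
    using l by (intro borel_measurable_add borel_measurable_group_uminus measurable_past_events) auto
  have np: "AE \<omega> in M. noise_product \<xi> (k - 1) l \<omega> + y = ?Y \<omega>"
    using noise_product_eq_diff[of "k - 1" l] k l by auto
  have "(\<integral>\<^sup>+\<omega>. f (noise_product \<xi> k l \<omega> + y) \<partial>M) = (\<integral>\<^sup>+\<omega>. indicator (space M) \<omega> * f (\<xi> k \<omega> + ?Y \<omega>) \<partial>M)"
    by (rule nn_integral_cong_AE, use np AE_space in eventually_elim)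
       (simp add: noise_product_rec[OF l] add.assoc)
  also have "\<dots> = (\<integral>\<^sup>+\<omega>. indicator (space M) \<omega> * (\<integral>\<^sup>+x. f (x + ?Y \<omega>) \<partial>\<mu> k) \<partial>M)"
    by (rule solution_freeze[OF k B Y f])
  also have "\<dots> = (\<integral>\<^sup>+\<omega>. (\<integral>\<^sup>+x. f (x + (noise_product \<xi> (k - 1) l \<omega> + y)) \<partial>\<mu> k) \<partial>M)"
    by (rule nn_integral_cong_AE, use np AE_space in eventually_elim) simp
  finally show ?thesis .
qed

lemma solution_markov:
  assumes "k \<le> 0" "l \<le> k + 1" "B \<in> past_events M \<eta> (l - 1)" "f \<in> borel_measurable borel"
  shows "(\<integral>\<^sup>+\<omega>. indicator B \<omega> * f (\<eta> k \<omega>) \<partial>M) =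
    (\<integral>\<^sup>+\<omega>. indicator B \<omega> * (\<integral>\<^sup>+\<omega>'. f (noise_product \<xi> k l \<omega>' + \<eta> (l - 1) \<omega>) \<partial>M) \<partial>M)"
proof -
  interpret prob_space M by (rule solution_prob_space[OF sol])
  have "l - 1 \<le> k" using assms by simp
  then have "k \<le> 0 \<longrightarrow> (\<forall>f\<in>borel_measurable borel. (\<integral>\<^sup>+\<omega>. indicator B \<omega> * f (\<eta> k \<omega>) \<partial>M) =
    (\<integral>\<^sup>+\<omega>. indicator B \<omega> * (\<integral>\<^sup>+\<omega>'. f (noise_product \<xi> k l \<omega>' + \<eta> (l - 1) \<omega>) \<partial>M) \<partial>M))"
  proof (induction k rule: int_ge_induct)
    case base
    then show ?case by (simp add: noise_product_empty emeasure_space_1)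
  next
    case (step k)
    show ?case
    proof (intro impI ballI)
      assume k: "k + 1 \<le> 0"
      fix f :: "'a \<Rightarrow> ennreal" assume f: "f \<in> borel_measurable borel"
      \<comment> \<open>Integrating out the latest noise turns the test function \<open>f\<close> at
        time \<open>k + 1\<close> into \<open>f'\<close> at time \<open>k\<close>; this is why the
        induction quantifies over all \<open>f\<close>.\<close>
      define f' where "f' y = (\<integral>\<^sup>+x. f (x + y) \<partial>\<mu> (k + 1))" for y
      have f': "f' \<in> borel_measurable borel"
        using borel_measurable_nn_integral_translate[OF solution_noise_law[OF sol k] f] by (simp add: f'_def[abs_def])
      have "B \<in> past_events M \<eta> (k + 1 - 1)"
        using assms(3) past_events_mono[of "l - 1" k M \<eta>] step(1) by auto
      note freeze = solution_freeze[OF k this measurable_past_events f]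
      have "(\<integral>\<^sup>+\<omega>. indicator B \<omega> * f (\<eta> (k + 1) \<omega>) \<partial>M) = (\<integral>\<^sup>+\<omega>. indicator B \<omega> * f (\<xi> (k + 1) \<omega> + \<eta> k \<omega>) \<partial>M)"
        by (rule nn_integral_cong_AE, use solution_AE[OF sol k] in eventually_elim) simp
      also have "\<dots> = (\<integral>\<^sup>+\<omega>. indicator B \<omega> * f' (\<eta> k \<omega>) \<partial>M)"
        unfolding f'_def by (rule freeze) simp
      also have "\<dots> = (\<integral>\<^sup>+\<omega>. indicator B \<omega> * (\<integral>\<^sup>+\<omega>'. f' (noise_product \<xi> k l \<omega>' + \<eta> (l - 1) \<omega>) \<partial>M) \<partial>M)"
        using step.IH f' k by simp
      also have "\<dots> = (\<integral>\<^sup>+\<omega>. indicator B \<omega> * (\<integral>\<^sup>+\<omega>'. f (noise_product \<xi> (k + 1) l \<omega>' + \<eta> (l - 1) \<omega>) \<partial>M) \<partial>M)"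
        using nn_integral_noise_product_rec[OF k _ f, of l] step(1) by (simp add: f'_def)
      finally show "(\<integral>\<^sup>+\<omega>. indicator B \<omega> * f (\<eta> (k + 1) \<omega>) \<partial>M) =
        (\<integral>\<^sup>+\<omega>. indicator B \<omega> * (\<integral>\<^sup>+\<omega>'. f (noise_product \<xi> (k + 1) l \<omega>' + \<eta> (l - 1) \<omega>) \<partial>M) \<partial>M)" .
    qed
  qed
  with assms show ?thesis by simp
qed

end

lemma emeasure_distr_eq_nn_integral:
  assumes "X \<in> measurable M N" "A \<in> sets N"
  shows "emeasure (distr M N X) A = (\<integral>\<^sup>+\<omega>. indicator A (X \<omega>) \<partial>M)"
proof -
  have "emeasure (distr M N X) A = (\<integral>\<^sup>+x. indicator A x \<partial>distr M N X)" using assms(2) by simp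
  also have "\<dots> = (\<integral>\<^sup>+\<omega>. indicator A (X \<omega>) \<partial>M)"
    by (rule nn_integral_distr[OF assms(1)]) (use assms(2) in simp)
  finally show ?thesis .
qed

text \<open>Peeling off the leftmost factor changes the test function by a kernel of
  \<open>\<mu>\<close> only, and the empty product does not see the solution at all. This allows two
  solutions on different probability spaces to be compared.\<close>

lemma noise_product_law_unique:
  fixes \<mu> :: "int \<Rightarrow> 'a::{topological_group_add, t2_space, second_countable_topology} measure"
  assumes sol: "solution \<mu> M \<eta> \<xi>" and sol': "solution \<mu> M' \<eta>' \<xi>'" and k: "k \<le> 0"
  shows "distr M borel (\<lambda>\<omega>. noise_product \<xi> k l \<omega> + y) = distr M' borel (\<lambda>\<omega>. noise_product \<xi>' k l \<omega> + y)"
proof -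
  interpret M: prob_space M by (rule solution_prob_space[OF sol])
  interpret M': prob_space M' by (rule solution_prob_space[OF sol'])
  have eq: "(\<integral>\<^sup>+\<omega>. f (noise_product \<xi> k l \<omega> + y) \<partial>M) = (\<integral>\<^sup>+\<omega>. f (noise_product \<xi>' k l \<omega> + y) \<partial>M')"
    if f: "f \<in> borel_measurable borel" for f
  proof (cases "l - 1 \<le> k")
    case True
    then have "k \<le> 0 \<longrightarrow> (\<forall>f\<in>borel_measurable borel.
      (\<integral>\<^sup>+\<omega>. f (noise_product \<xi> k l \<omega> + y) \<partial>M) = (\<integral>\<^sup>+\<omega>. f (noise_product \<xi>' k l \<omega> + y) \<partial>M'))"
    proof (induction k rule: int_ge_induct)
      case base
      then show ?case by (simp add: noise_product_empty M.emeasure_space_1 M'.emeasure_space_1)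
    next
      case (step k)
      show ?case
      proof (intro impI ballI)
        assume k: "k + 1 \<le> 0"
        fix f :: "'a \<Rightarrow> ennreal" assume f: "f \<in> borel_measurable borel"
        define f' where "f' y = (\<integral>\<^sup>+x. f (x + y) \<partial>\<mu> (k + 1))" for y
        have "f' \<in> borel_measurable borel"
          unfolding f'_def[abs_def] by (rule borel_measurable_nn_integral_translate[OF solution_noise_law[OF sol k] f])
        with step.IH k step(1) show "(\<integral>\<^sup>+\<omega>. f (noise_product \<xi> (k + 1) l \<omega> + y) \<partial>M) =
          (\<integral>\<^sup>+\<omega>. f (noise_product \<xi>' (k + 1) l \<omega> + y) \<partial>M')"
          using nn_integral_noise_product_rec[OF sol k _ f, of l y] nn_integral_noise_product_rec[OF sol' k _ f, of l y]
          by (simp flip: f'_def)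
      qed
    qed
    with k f show ?thesis by simp
  next
    case False
    then show ?thesis by (simp add: noise_product_empty M.emeasure_space_1 M'.emeasure_space_1)
  qed
  have [measurable]: "noise_product \<xi> k l \<in> borel_measurable M" "noise_product \<xi>' k l \<in> borel_measurable M'"
    using measurable_noise_product sol sol' k by blast+
  show ?thesis
  proof (rule measure_eqI)
    fix A assume "A \<in> sets (distr M borel (\<lambda>\<omega>. noise_product \<xi> k l \<omega> + y))"
    then have [measurable]: "A \<in> sets borel" by simp
    show "emeasure (distr M borel (\<lambda>\<omega>. noise_product \<xi> k l \<omega> + y)) A =
      emeasure (distr M' borel (\<lambda>\<omega>. noise_product \<xi>' k l \<omega> + y)) A"
      using eq[of "indicator A"] by (simp add: emeasure_distr_eq_nn_integral)
  qed simp
qed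

text \<open>As a function of the position at time \<open>l - 1\<close>: the expectation of
  \<open>f\<close> at time \<open>l - 1 + int n\<close>, restricted to paths that lie in
  \<open>C j\<close> at each time \<open>j\<close> in between, end included. The latest noise is
  integrated out first, so the function argument changes along the recursion.\<close>

primrec cylinder_kernel ::
  "(int \<Rightarrow> 'a::plus measure) \<Rightarrow> (int \<Rightarrow> 'a set) \<Rightarrow> int \<Rightarrow> nat \<Rightarrow> ('a \<Rightarrow> ennreal) \<Rightarrow> 'a \<Rightarrow> ennreal"
  where
    "cylinder_kernel \<mu> C l 0 f = f"
  | "cylinder_kernel \<mu> C l (Suc n) f = cylinder_kernel \<mu> C l n
      (\<lambda>y. \<integral>\<^sup>+x. indicator (C (l + int n)) (x + y) * f (x + y) \<partial>\<mu> (l + int n))"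

lemma nn_integral_cylinder:
  fixes \<mu> :: "int \<Rightarrow> 'a::{topological_group_add, t2_space, second_countable_topology} measure"
  assumes sol: "solution \<mu> M \<eta> \<xi>" and C: "\<And>j. C j \<in> sets borel"
    and "l - 1 + int n \<le> 0" "f \<in> borel_measurable borel"
  shows "(\<integral>\<^sup>+\<omega>. indicator {\<omega> \<in> space M. \<forall>j\<in>{l..l - 1 + int n}. \<eta> j \<omega> \<in> C j} \<omega> * f (\<eta> (l - 1 + int n) \<omega>) \<partial>M) =
    (\<integral>\<^sup>+x. cylinder_kernel \<mu> C l n f x \<partial>distr M borel (\<eta> (l - 1)))"
  using assms(3,4)
proof (induction n arbitrary: f)
  case 0
  then show ?case
    by (subst nn_integral_distr[OF solution_measurable(1)[OF sol]])
       (auto intro!: nn_integral_cong)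
next
  case (Suc n)
  define k where "k = l - 1 + int n"
  have k: "k + 1 \<le> 0" "l + int n = k + 1" "l - 1 + int (Suc n) = k + 1" and lk: "l - 1 \<le> k"
    using Suc.prems(1) by (auto simp: k_def)
  define E where "E i = {\<omega> \<in> space M. \<forall>j\<in>{l..i}. \<eta> j \<omega> \<in> C j}" for i
  have E_past: "E k \<in> past_events M \<eta> (k + 1 - 1)"
  proof -
    interpret sigma_algebra "space M" "past_events M \<eta> k" by (rule sigma_algebra_past_events)
    have "E k = space M \<inter> (\<Inter>j\<in>{l..k}. \<eta> j -` C j \<inter> space M)"
      by (auto simp: E_def)
    moreover have "\<eta> j -` C j \<inter> space M \<in> past_events M \<eta> k" if "j \<le> k" for j
      using measurable_sets[OF measurable_past_events[where M=M and \<eta>=\<eta>, OF that] C[of j]]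
      by (simp add: space_measure_of_conv)
    then have "(\<Inter>j\<in>{l..k}. \<eta> j -` C j \<inter> space M) \<in> past_events M \<eta> k" if "{l..k} \<noteq> {}"
      using that by (intro finite_INT) auto
    ultimately show ?thesis
      by (cases "{l..k} = {}") auto
  qed
  note [measurable] = C Suc.prems(2)
  define g where "g x = indicator (C (k + 1)) x * f x" for x
  have g: "g \<in> borel_measurable borel" unfolding g_def by measurable
  have "{l..k + 1} = insert (k + 1) {l..k}" using lk by auto
  then have E_step: "indicator (E (k + 1)) \<omega> * f (\<eta> (k + 1) \<omega>) = indicator (E k) \<omega> * g (\<eta> (k + 1) \<omega>)" for \<omega>
    by (auto simp: E_def g_def indicator_def)
  have IH: "(\<integral>\<^sup>+\<omega>. indicator (E k) \<omega> * h (\<eta> k \<omega>) \<partial>M) =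
      (\<integral>\<^sup>+x. cylinder_kernel \<mu> C l n h x \<partial>distr M borel (\<eta> (l - 1)))"
    if "h \<in> borel_measurable borel" for h
    using Suc.IH[OF _ that] Suc.prems(1) unfolding E_def k_def by simp
  have "(\<integral>\<^sup>+\<omega>. indicator (E (k + 1)) \<omega> * f (\<eta> (k + 1) \<omega>) \<partial>M) =
      (\<integral>\<^sup>+\<omega>. indicator (E k) \<omega> * g (\<xi> (k + 1) \<omega> + \<eta> k \<omega>) \<partial>M)"
    by (rule nn_integral_cong_AE, use solution_AE[OF sol k(1)] in eventually_elim) (subst E_step, simp)
  also have "\<dots> = (\<integral>\<^sup>+\<omega>. indicator (E k) \<omega> * (\<integral>\<^sup>+x. g (x + \<eta> k \<omega>) \<partial>\<mu> (k + 1)) \<partial>M)"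
    by (rule solution_freeze[OF sol k(1) E_past _ g]) (auto intro: measurable_past_events)
  also have "\<dots> = (\<integral>\<^sup>+x. cylinder_kernel \<mu> C l n (\<lambda>y. \<integral>\<^sup>+x. g (x + y) \<partial>\<mu> (k + 1)) x \<partial>distr M borel (\<eta> (l - 1)))"
    by (rule IH[OF borel_measurable_nn_integral_translate[OF solution_noise_law[OF sol k(1)] g]])
  finally show ?case unfolding k(3) by (simp add: E_def g_def k(2))
qed

text \<open>Every cylinder probability is the integral of a kernel built from \<open>\<mu>\<close>
  against the marginal at the time just before the cylinder starts. Kernel and marginal agree for
  both solutions.\<close>

lemma process_law_eqI:
  fixes \<mu> :: "int \<Rightarrow> 'a::{topological_group_add, t2_space, second_countable_topology} measure"
  assumes sol: "solution \<mu> M \<eta> \<xi>" and sol': "solution \<mu> M' \<eta>' \<xi>'"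
    and eq: "\<And>k. k \<le> 0 \<Longrightarrow> distr M borel (\<eta> k) = distr M' borel (\<eta>' k)"
  shows "process_law M \<eta> = process_law M' \<eta>'"
proof -
  interpret M: prob_space M by (rule solution_prob_space[OF sol])
  interpret M': prob_space M' by (rule solution_prob_space[OF sol'])
  let ?S = "PiM {..0::int} (\<lambda>_. borel :: 'a measure)"
  let ?p = "\<lambda>\<omega>. \<lambda>k\<in>{..0}. \<eta> k \<omega>" and ?p' = "\<lambda>\<omega>. \<lambda>k\<in>{..0}. \<eta>' k \<omega>"
  have p: "?p \<in> measurable M ?S" and p': "?p' \<in> measurable M' ?S"
    by (intro process_measurable solution_measurable[OF sol] solution_measurable[OF sol']; assumption)+
  show ?thesis unfolding process_law_def
  proof (rule measure_eqI_PiM_infinite)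
    show "finite_measure (distr M ?S ?p)"
      using M.prob_space_distr[OF p] prob_space.finite_measure by blast
    fix A :: "int \<Rightarrow> 'a set" and J :: "int set"
    assume J: "finite J" "J \<subseteq> {..0}" and A: "\<And>i. i \<in> J \<Longrightarrow> A i \<in> sets borel"
    \<comment> \<open>Filling the gaps of \<open>J\<close> with trivial constraints turns the
      cylinder into one over a full interval of times.\<close>
    define C where "C i = (if i \<in> J then A i else UNIV)" for i
    have C: "C i \<in> sets borel" for i using A by (simp add: C_def)
    \<comment> \<open>The 1 makes the minimum exist for empty \<open>J\<close>; then
      \<open>{l..0}\<close> is empty and no kernel step is taken. In general
      \<open>nat (1 - l)\<close> steps lead from time \<open>l - 1\<close> to time 0.\<close>
    define l where "l = Min (insert 1 J)"
    have l: "l \<le> 1" "\<And>j. j \<in> J \<Longrightarrow> l \<le> j" using J(1) by (auto simp: l_def)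
    have n: "l - 1 + int (nat (1 - l)) = 0" using l(1) by simp
    let ?D = "prod_emb {..0} (\<lambda>_. borel) J (Pi\<^sub>E J A)"
    have D: "?D \<in> sets ?S" using J A by (intro sets_PiM_I) auto
    have pre: "(\<lambda>k\<in>{..0}. x k) \<in> ?D \<longleftrightarrow> (\<forall>j\<in>{l..0}. x j \<in> C j)" for x :: "int \<Rightarrow> 'a"
      using J(2) l(2) by (auto simp: prod_emb_def C_def PiE_iff restrict_def extensional_def)
    have "emeasure (distr M ?S ?p) ?D = emeasure M {\<omega> \<in> space M. \<forall>j\<in>{l..0}. \<eta> j \<omega> \<in> C j}"
      using p D pre by (subst emeasure_distr) (auto intro!: arg_cong[where f="emeasure M"])
    also have "\<dots> = (\<integral>\<^sup>+\<omega>. indicator {\<omega> \<in> space M. \<forall>j\<in>{l..0}. \<eta> j \<omega> \<in> C j} \<omega> \<partial>M)"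
      using measurable_sets[OF p D] pre
      by (intro nn_integral_indicator[symmetric]) (simp add: vimage_def Int_def conj_commute)
    also have "\<dots> = (\<integral>\<^sup>+x. cylinder_kernel \<mu> C l (nat (1 - l)) (\<lambda>_. 1) x \<partial>distr M borel (\<eta> (l - 1)))"
      using nn_integral_cylinder[OF sol, of C l "nat (1 - l)" "\<lambda>_. 1"] C n by simp
    also have "\<dots> = (\<integral>\<^sup>+x. cylinder_kernel \<mu> C l (nat (1 - l)) (\<lambda>_. 1) x \<partial>distr M' borel (\<eta>' (l - 1)))"
      using eq[of "l - 1"] l(1) by simp
    also have "\<dots> = (\<integral>\<^sup>+\<omega>. indicator {\<omega> \<in> space M'. \<forall>j\<in>{l..0}. \<eta>' j \<omega> \<in> C j} \<omega> \<partial>M')"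
      using nn_integral_cylinder[OF sol', of C l "nat (1 - l)" "\<lambda>_. 1"] C n by simp
    also have "\<dots> = emeasure M' {\<omega> \<in> space M'. \<forall>j\<in>{l..0}. \<eta>' j \<omega> \<in> C j}"
      using measurable_sets[OF p' D] pre
      by (intro nn_integral_indicator) (simp add: vimage_def Int_def conj_commute)
    also have "\<dots> = emeasure (distr M' ?S ?p') ?D"
      using p' D pre by (subst emeasure_distr) (auto intro!: arg_cong[where f="emeasure M'"])
    finally show "emeasure (distr M ?S ?p) ?D = emeasure (distr M' ?S ?p') ?D" .
  qed simp_all
qed

section \<open>Translated and conditioned solutions, tail triviality\<close>

text \<open>By associativity a right translation passes through the left multiplication by the
  noise, and it adds no events to the past.\<close>

lemma solution_translate:
  fixes \<mu> :: "int \<Rightarrow> 'a::{topological_group_add, t2_space, second_countable_topology} measure"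
  assumes sol: "solution \<mu> M \<eta> \<xi>"
  shows "solution \<mu> M (\<lambda>k \<omega>. \<eta> k \<omega> + g) \<xi>"
proof -
  interpret prob_space M by (rule solution_prob_space[OF sol])
  have past: "past_events M (\<lambda>k \<omega>. \<eta> k \<omega> + g) j \<subseteq> past_events M \<eta> j" for j
    unfolding past_events_def
  proof (intro sigma_sets_mono subsetI)
    fix B assume "B \<in> {(\<lambda>\<omega>. \<eta> m \<omega> + g) -` A \<inter> space M |m A. m \<le> j \<and> A \<in> sets borel}"
    then obtain m A where mA: "m \<le> j" "A \<in> sets borel" "B = (\<lambda>\<omega>. \<eta> m \<omega> + g) -` A \<inter> space M" by auto
    have "(\<lambda>x. x + g) -` A \<in> sets borel"
      using mA(2) by (intro measurable_sets_borel[OF _ mA(2)] borel_measurable_add) auto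
    moreover have "B = \<eta> m -` ((\<lambda>x. x + g) -` A) \<inter> space M" using mA(3) by auto
    ultimately show "B \<in> sigma_sets (space M) {\<eta> m -` A \<inter> space M |m A. m \<le> j \<and> A \<in> sets borel}"
      using mA(1) by (intro sigma_sets.Basic) blast
  qed
  show ?thesis unfolding solution_def
  proof (intro conjI allI impI)
    fix k :: int assume k: "k \<le> 0"
    note [measurable] = solution_measurable[OF sol k]
    show "(\<lambda>\<omega>. \<eta> k \<omega> + g) \<in> borel_measurable M" "\<xi> k \<in> borel_measurable M" by measurable
    show "AE \<omega> in M. \<eta> k \<omega> + g = \<xi> k \<omega> + (\<eta> (k - 1) \<omega> + g)"
      using solution_AE[OF sol k] by eventually_elim (simp add: add.assoc)
    show "indep_set {\<xi> k -` A \<inter> space M |A. A \<in> sets borel} (past_events M (\<lambda>k \<omega>. \<eta> k \<omega> + g) (k - 1))"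
      using solution_indep[OF sol k] past[of "k - 1"]
      unfolding indep_sets2_eq by blast
    show "distr M borel (\<xi> k) = \<mu> k" by (rule solution_law[OF sol k])
  qed (rule prob_space_axioms)
qed

text \<open>\<open>T\<close> belongs to every past, so intersecting a past event with
  \<open>T\<close> gives a past event again; the noise stays independent of it and keeps its
  law.\<close>

lemma solution_conditioned:
  fixes \<mu> :: "int \<Rightarrow> 'a::{topological_group_add, t2_space, second_countable_topology} measure"
  assumes sol: "solution \<mu> M \<eta> \<xi>"
    and T: "\<And>j. T \<in> past_events M \<eta> j" and pos: "measure M T > 0"
  shows "solution \<mu> (uniform_measure M T) \<eta> \<xi>"
proof -
  interpret prob_space M using sol by (simp add: solution_def)
  let ?U = "uniform_measure M T"
  note sub = past_events_subset[OF sol]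
  have Tev: "T \<in> events" using T[of 0] sub[of 0] by auto
  have U: "prob_space ?U"
    using pos by (intro prob_space_uniform_measure) (auto simp: emeasure_eq_measure)
  have prob_U: "measure ?U B = prob (B \<inter> T) / prob T" if "B \<in> events" for B
    using that Tev pos by (simp add: measure_uniform_measure Int_commute emeasure_eq_measure)
  have pastU: "past_events ?U \<eta> j = past_events M \<eta> j" for j
    by (simp add: past_events_def)
  have ind: "prob ((\<xi> k -` A \<inter> space M) \<inter> B) = prob (\<xi> k -` A \<inter> space M) * prob B"
    if "k \<le> 0" "A \<in> sets borel" "B \<in> past_events M \<eta> (k - 1)" for k A B
    using sol that by (intro indep_setD[where A="{\<xi> k -` A \<inter> space M |A. A \<in> sets borel}"]) (auto simp: solution_def)
  have noise: "measure ?U (\<xi> k -` A \<inter> space M) = prob (\<xi> k -` A \<inter> space M)" "\<xi> k -` A \<inter> space M \<in> events"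
    if "k \<le> 0" "A \<in> sets borel" for k A
  proof -
    show ev: "\<xi> k -` A \<inter> space M \<in> events" using sol that by (auto simp: solution_def intro: measurable_sets)
    show "measure ?U (\<xi> k -` A \<inter> space M) = prob (\<xi> k -` A \<inter> space M)"
      using ind[OF that T] pos by (simp add: prob_U[OF ev])
  qed
  show ?thesis unfolding solution_def
  proof (intro conjI allI impI)
    show "prob_space ?U" by (rule U)
    fix k :: int assume k: "k \<le> 0"
    show "\<eta> k \<in> borel_measurable ?U" "\<xi> k \<in> borel_measurable ?U"
      using sol k by (auto simp: solution_def cong: measurable_cong_sets)
    show "AE \<omega> in ?U. \<eta> k \<omega> = \<xi> k \<omega> + \<eta> (k - 1) \<omega>"
      using sol k Tev by (intro AE_uniform_measureI) (auto simp: solution_def)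
    show "prob_space.indep_set ?U {\<xi> k -` A \<inter> space ?U |A. A \<in> sets borel} (past_events ?U \<eta> (k - 1))"
      unfolding prob_space.indep_sets2_eq[OF U] pastU
    proof (intro conjI ballI)
      show "{\<xi> k -` A \<inter> space ?U |A. A \<in> sets borel} \<subseteq> sets ?U"
        using noise(2)[OF k] by auto
      show "past_events M \<eta> (k - 1) \<subseteq> sets ?U" using sub[of "k - 1"] k by simp
      fix a B assume "a \<in> {\<xi> k -` A \<inter> space ?U |A. A \<in> sets borel}" and B: "B \<in> past_events M \<eta> (k - 1)"
      then obtain A where A: "A \<in> sets borel" "a = \<xi> k -` A \<inter> space M" by auto
      have Bev: "B \<in> events" using B sub[of "k - 1"] k by auto
      interpret S: sigma_algebra "space M" "past_events M \<eta> (k - 1)" by (rule sigma_algebra_past_events)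
      have "measure ?U (a \<inter> B) = prob (a \<inter> (B \<inter> T)) / prob T"
        using prob_U[of "a \<inter> B"] noise(2)[OF k A(1)] A(2) Bev unfolding Int_assoc[of a B T] by blast
      also have "\<dots> = prob a * prob (B \<inter> T) / prob T"
        using ind[OF k A(1), of "B \<inter> T"] B T A(2) by auto
      also have "\<dots> = measure ?U a * measure ?U B"
        using noise(1)[OF k A(1)] A(2) Bev by (simp add: prob_U)
      finally show "measure ?U (a \<inter> B) = measure ?U a * measure ?U B" .
    qed
    show "distr ?U borel (\<xi> k) = \<mu> k"
    proof -
      have "distr ?U borel (\<xi> k) = distr M borel (\<xi> k)"
      proof (rule measure_eqI)
        fix A assume "A \<in> sets (distr ?U borel (\<xi> k))"
        then have A: "A \<in> sets borel" by simp
        have "\<xi> k \<in> borel_measurable M" using sol k by (auto simp: solution_def)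
        moreover from this have "\<xi> k \<in> borel_measurable ?U" by (simp cong: measurable_cong_sets)
        ultimately show "emeasure (distr ?U borel (\<xi> k)) A = emeasure (distr M borel (\<xi> k)) A"
          using A noise(1)[OF k A]
          by (simp add: emeasure_distr emeasure_eq_measure
              finite_measure.emeasure_eq_measure[OF prob_space.finite_measure[OF U]])
      qed simp
      then show ?thesis using sol k by (simp add: solution_def)
    qed
  qed
qed

text \<open>Conditioning on a tail event of probability in \<open>(0, 1)\<close> would split the law of \<open>\<eta>\<close>.\<close>

lemma extremal_solution_tail_trivial:
  fixes \<mu> :: "int \<Rightarrow> 'a::{topological_group_add, t2_space, second_countable_topology} measure"
  assumes ext: "extremal_solution \<mu> M \<eta> \<xi>" and T: "\<And>j. T \<in> past_events M \<eta> j"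
  shows "measure M T = 0 \<or> measure M T = 1"
proof (rule ccontr)
  assume "\<not> ?thesis"
  then have ne: "measure M T \<noteq> 0" "measure M T \<noteq> 1" by auto
  have sol: "solution \<mu> M \<eta> \<xi>" using ext by (simp add: extremal_solution_def)
  interpret prob_space M by (rule solution_prob_space[OF sol])
  let ?S = "PiM {..0::int} (\<lambda>_. borel :: 'a measure)"
  let ?p = "\<lambda>\<omega>. \<lambda>k\<in>{..0}. \<eta> k \<omega>"
  define t where "t = prob T"
  define T' where "T' = space M - T"
  have Tev: "T \<in> events" using T[of 0] past_events_subset[OF sol, of 0] by auto
  have t: "0 < t" "t < 1" using ne prob_le_1[of T] measure_nonneg[of M T] by (auto simp: t_def less_le)
  have T': "T' \<in> past_events M \<eta> j" for j
    using T[of j] sigma_algebra_past_events[of M \<eta> j] unfolding T'_def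
    by (meson sigma_algebra_iff2)
  have T'ev: "T' \<in> events" and pT': "prob T' = 1 - t"
    using Tev by (auto simp: T'_def t_def prob_compl)
  let ?P = "process_law M \<eta>" and ?P1 = "process_law (uniform_measure M T) \<eta>"
    and ?P2 = "process_law (uniform_measure M T') \<eta>"
  have p: "?p \<in> measurable M ?S"
    by (intro process_measurable solution_measurable[OF sol])
  have pU: "?p \<in> measurable (uniform_measure M R) ?S" for R
    using p by (simp cong: measurable_cong_sets)
  have law: "measure ?P A = prob (?p -` A \<inter> space M)" if "A \<in> sets ?S" for A
    unfolding process_law_def by (rule measure_distr[OF p that])
  have lawU: "measure (process_law (uniform_measure M R) \<eta>) A = prob (R \<inter> (?p -` A \<inter> space M)) / prob R"
    if "A \<in> sets ?S" "R \<in> events" "prob R > 0" for A R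
    unfolding process_law_def using measure_distr[OF pU that(1)] measurable_sets[OF p that(1)] that(2,3)
    by (simp add: measure_uniform_measure emeasure_eq_measure)
  have sol1: "?P1 \<in> solution_laws \<mu>" "?P2 \<in> solution_laws \<mu>"
    using solution_conditioned[OF sol T] solution_conditioned[OF sol T'] t pT'
    by (auto intro!: process_law_in_solution_laws simp: t_def)
  have decomp: "measure ?P A = t * measure ?P1 A + (1 - t) * measure ?P2 A" if "A \<in> sets ?P" for A
  proof -
    have A: "A \<in> sets ?S" using that by (simp add: process_law_def)
    let ?B = "?p -` A \<inter> space M"
    have B: "?B \<in> events" by (rule measurable_sets[OF p A])
    have "?B = (T \<inter> ?B) \<union> (T' \<inter> ?B)" "(T \<inter> ?B) \<inter> (T' \<inter> ?B) = {}" by (auto simp: T'_def)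
    then have "prob ?B = prob (T \<inter> ?B) + prob (T' \<inter> ?B)"
      using finite_measure_Union[of "T \<inter> ?B" "T' \<inter> ?B"] Tev T'ev B by auto
    then show ?thesis using t by (simp add: law lawU A Tev T'ev pT' flip: t_def)
  qed
  have P1: "?P1 = ?P"
    using ext sol1 t decomp unfolding extremal_solution_def extremal_law_def by blast
  \<comment> \<open>\<open>T\<close> is an event of the path, so the equality \<open>P1\<close> of
    laws can be evaluated on it: \<open>T\<close> has the same probability before and after
    conditioning on \<open>T\<close>, which is then 1.\<close>
  have "\<exists>A\<in>sets ?S. T = ?p -` A \<inter> space M"
    using T[of 0] unfolding past_events_def
  proof (induction rule: sigma_sets.induct)
    case (Basic B)
    then obtain m A where mA: "m \<le> 0" "A \<in> sets borel" "B = \<eta> m -` A \<inter> space M" by auto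
    have "(\<lambda>x. x m) -` A \<inter> space ?S \<in> sets ?S"
      using mA by (intro measurable_sets[of _ _ borel] measurable_component_singleton) auto
    moreover have "B = ?p -` ((\<lambda>x. x m) -` A \<inter> space ?S) \<inter> space M"
      using mA measurable_space[OF p] by auto
    ultimately show ?case by blast
  next
    case Empty
    show ?case by (rule bexI[of _ "{}"]) auto
  next
    case (Compl B)
    from Compl.IH obtain A where A: "A \<in> sets ?S" "B = ?p -` A \<inter> space M" by blast
    then have "space M - B = ?p -` (space ?S - A) \<inter> space M"
      using measurable_space[OF p] by auto
    then show ?case using sets.compl_sets[OF A(1)] by (rule bexI)
  next
    case (Union B)
    have "\<forall>i. \<exists>A. A \<in> sets ?S \<and> B i = ?p -` A \<inter> space M" using Union.IH by blast
    from choice[OF this] obtain A where A: "\<forall>i. A i \<in> sets ?S \<and> B i = ?p -` A i \<inter> space M" ..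
    then have "B i = ?p -` A i \<inter> space M" for i by blast
    then have "(\<Union>i. B i) = ?p -` (\<Union>i. A i) \<inter> space M" by (simp only: vimage_UN) blast
    moreover have "(\<Union>i. A i) \<in> sets ?S" using A by blast
    ultimately show ?case by (rule bexI)
  qed
  then obtain A where A: "A \<in> sets ?S" "T = ?p -` A \<inter> space M" by blast
  have "prob T = measure ?P A" using law[OF A(1)] A(2) by simp
  also have "\<dots> = measure ?P1 A" by (simp only: P1)
  also have "\<dots> = prob (T \<inter> T) / prob T"
    using lawU[OF A(1) Tev] t(1) unfolding t_def A(2)[symmetric] by blast
  finally show False using ne by simp
qed

section \<open>Convergence of the laws started from a typical past\<close>

lemma tendsto_at_bot_int:
  fixes f :: "int \<Rightarrow> 'a::topological_space"
  assumes "(\<lambda>n. f (k - int n)) \<longlonglongrightarrow> c"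
  shows "(f \<longlongrightarrow> c) at_bot"
proof -
  have "filterlim (\<lambda>l. nat (k - l)) sequentially at_bot"
    unfolding filterlim_at_top eventually_at_bot_linorder
  proof
    fix N :: nat
    show "\<exists>M. \<forall>l\<le>M. N \<le> nat (k - l)" by (rule exI[of _ "k - int N"]) auto
  qed
  from filterlim_compose[OF assms this] have "((\<lambda>l. f (k - int (nat (k - l)))) \<longlongrightarrow> c) at_bot" .
  then show ?thesis
    by (rule Lim_transform_eventually) (auto simp: eventually_at_bot_linorder intro!: exI[of _ k])
qed

text \<open>By the Markov property the measured quantity is the conditional probability of
  \<open>\<eta> k\<close> lying in \<open>A\<close>, given the past up to time \<open>l - 1\<close>.
  These pasts decrease to the trivial tail, so it tends to the unconditional probability.\<close>

lemma extremal_solution_AE_transition_tendsto: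
  fixes \<mu> :: "int \<Rightarrow> 'a::{topological_group_add, t2_space, second_countable_topology} measure"
  assumes ext: "extremal_solution \<mu> M \<eta> \<xi>" and k: "k \<le> 0" and A: "A \<in> sets borel"
  shows "AE \<omega>0 in M. ((\<lambda>l. measure (distr M borel (\<lambda>\<omega>. noise_product \<xi> k l \<omega> + \<eta> (l - 1) \<omega>0)) A)
    \<longlongrightarrow> measure (distr M borel (\<eta> k)) A) at_bot"
proof -
  have sol: "solution \<mu> M \<eta> \<xi>" using ext by (simp add: extremal_solution_def)
  interpret prob_space M by (rule solution_prob_space[OF sol])
  note [measurable] = solution_measurable(1)[OF sol k] measurable_noise_product[OF sol k] A
  define F where "F n = past_events M \<eta> (k - int n - 1)" for n
  define Q where "Q l y = (\<integral>\<^sup>+\<omega>. indicator A (noise_product \<xi> k l \<omega> + y) \<partial>M)" for l and y :: 'a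
  \<comment> \<open>The \<open>n\<close>-th backward step uses \<open>l = k - int n\<close>, so the
    starting time is \<open>l - 1\<close>, the last time visible in \<open>F n\<close>.\<close>
  define X where "X n \<omega> = enn2real (Q (k - int n) (\<eta> (k - int n - 1) \<omega>))" for n \<omega>
  have Q: "Q l y = emeasure (distr M borel (\<lambda>\<omega>. noise_product \<xi> k l \<omega> + y)) A" for l y
    unfolding Q_def by (rule emeasure_distr_eq_nn_integral[symmetric]) measurable
  have Q1: "Q l y \<le> 1" for l y
    unfolding Q by (intro prob_space.emeasure_le_1 prob_space_distr) measurable
  then have Q_fin: "ennreal (enn2real (Q l y)) = Q l y" for l y
    by (intro ennreal_enn2real) (meson ennreal_one_less_top le_less_trans)
  have [measurable]: "Q l \<in> borel_measurable borel" for l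
  proof -
    let ?L = "distr M borel (noise_product \<xi> k l)"
    have "(\<lambda>y. \<integral>\<^sup>+x. indicator A (x + y) \<partial>?L) \<in> borel_measurable borel"
      by (rule borel_measurable_nn_integral_translate) (auto intro!: prob_space_distr)
    also have "(\<lambda>y. \<integral>\<^sup>+x. indicator A (x + y) \<partial>?L) = Q l"
      unfolding Q_def by (auto simp: nn_integral_distr)
    finally show ?thesis .
  qed
  have F_ev: "F n \<subseteq> events" for n
    unfolding F_def using k by (intro past_events_subset[OF sol]) simp
  have X_meas: "X n \<in> borel_measurable (sigma (space M) (F n))" for n
  proof -
    have [measurable]: "\<eta> (k - int n - 1) \<in> borel_measurable (sigma (space M) (F n))"
      unfolding F_def by (rule measurable_past_events) simp
    show ?thesis unfolding X_def by measurable
  qed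
  have X_meas': "X n \<in> borel_measurable M" for n
  proof -
    have [measurable]: "\<eta> (k - int n - 1) \<in> borel_measurable M"
      using solution_measurable(1)[OF sol, of "k - int n - 1"] k by simp
    show ?thesis unfolding X_def by measurable
  qed
  have X_nonneg: "0 \<le> X n \<omega>" and X_le1: "X n \<omega> \<le> 1" for n \<omega>
    using enn2real_mono[OF Q1] by (auto simp: X_def)
  have X_int: "integrable M (X n)" for n
    using X_meas' X_nonneg X_le1 by (intro integrable_const_bound[of _ 1]) auto
  have "AE \<omega>0 in M. (\<lambda>n. X n \<omega>0) \<longlonglongrightarrow> prob (\<eta> k -` A \<inter> space M)"
  proof (rule backward_martingale_convergence[OF _ F_ev _ _ _ X_meas X_int])
    show "sigma_algebra (space M) (F n)" for n
      unfolding F_def by (rule sigma_algebra_past_events)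
    show "decseq F"
      unfolding decseq_def F_def by (auto intro: subsetD[OF past_events_mono, rotated])
    show "prob T = 0 \<or> prob T = 1" if T: "\<And>n. T \<in> F n" for T
    proof (rule extremal_solution_tail_trivial[OF ext])
      fix j
      have "k - int (nat (k - j)) - 1 \<le> j" by simp
      from subsetD[OF past_events_mono[OF this]] T[of "nat (k - j)"]
      show "T \<in> past_events M \<eta> j" by (simp add: F_def)
    qed
    show "\<eta> k -` A \<inter> space M \<in> events" by measurable
    fix n B assume B: "B \<in> F n"
    then have [measurable]: "B \<in> events" using F_ev by auto
    have "ennreal (prob ((\<eta> k -` A \<inter> space M) \<inter> B)) = (\<integral>\<^sup>+\<omega>. indicator ((\<eta> k -` A \<inter> space M) \<inter> B) \<omega> \<partial>M)"
      by (simp add: emeasure_eq_measure)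
    also have "\<dots> = (\<integral>\<^sup>+\<omega>. indicator B \<omega> * indicator A (\<eta> k \<omega>) \<partial>M)"
      by (intro nn_integral_cong) (auto simp: indicator_def)
    also have "\<dots> = (\<integral>\<^sup>+\<omega>. indicator B \<omega> * Q (k - int n) (\<eta> (k - int n - 1) \<omega>) \<partial>M)"
      unfolding Q_def using B by (intro solution_markov[OF sol k]) (auto simp: F_def)
    also have "\<dots> = (\<integral>\<^sup>+\<omega>. ennreal (indicator B \<omega> * X n \<omega>) \<partial>M)"
      by (intro nn_integral_cong) (auto simp: X_def indicator_def Q_fin)
    also have "\<dots> = ennreal (\<integral>\<omega>. indicator B \<omega> * X n \<omega> \<partial>M)"
      using integrable_mult_indicator[OF \<open>B \<in> events\<close> X_int] X_nonneg
      by (intro nn_integral_eq_integral) (auto simp: mult_nonneg_nonneg)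
    finally show "prob ((\<eta> k -` A \<inter> space M) \<inter> B) = (\<integral>\<omega>. indicator B \<omega> * X n \<omega> \<partial>M)"
      using X_nonneg by (subst (asm) ennreal_inj) (auto intro!: integral_nonneg_AE)
  qed
  then show ?thesis
  proof eventually_elim
    case (elim \<omega>0)
    show ?case
      by (rule tendsto_at_bot_int[of _ k])
         (use elim in \<open>simp add: X_def Q measure_def[symmetric] measure_distr[of "\<eta> k"]\<close>)
  qed
qed

text \<open>Countably many times \<open>k\<close> and countably many test sets leave one null set
  outside which a frozen path serves for all \<open>k\<close> simultaneously.\<close>

lemma extremal_solution_AE_weakly_converges:
  fixes \<mu> :: "int \<Rightarrow> 'a::{topological_group_add, t2_space, second_countable_topology} measure"
  assumes cpt: "compact (UNIV :: 'a set)" and ext: "extremal_solution \<mu> M \<eta> \<xi>"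
  shows "AE \<omega>0 in M. cond_E1 M \<eta> \<xi> (\<lambda>l. \<eta> (l - 1) \<omega>0)"
proof -
  have sol: "solution \<mu> M \<eta> \<xi>" using ext by (simp add: extremal_solution_def)
  interpret prob_space M by (rule solution_prob_space[OF sol])
  show ?thesis
  proof (rule countable_weak_convergence_determining[OF cpt, where 'i=int])
    fix \<A> :: "'a set set"
    assume \<A>: "countable \<A>" "\<A> \<subseteq> sets borel"
      and weak: "\<And>(P :: int \<Rightarrow> 'a measure) Q F. \<lbrakk>\<And>i. prob_space (P i); \<And>i. sets (P i) = sets borel;
         prob_space Q; sets Q = sets borel;
         \<And>A. A \<in> \<A> \<Longrightarrow> ((\<lambda>i. measure (P i) A) \<longlongrightarrow> measure Q A) F\<rbrakk> \<Longrightarrow> weakly_converges P Q F"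
    have "AE \<omega>0 in M. \<forall>A\<in>\<A>. ((\<lambda>l. measure (distr M borel (\<lambda>\<omega>. noise_product \<xi> k l \<omega> + \<eta> (l - 1) \<omega>0)) A)
      \<longlongrightarrow> measure (distr M borel (\<eta> k)) A) at_bot" if "k \<le> 0" for k
      using \<A> extremal_solution_AE_transition_tendsto[OF ext that] by (auto simp: AE_ball_countable)
    then have "AE \<omega>0 in M. \<forall>k\<in>{..0}. \<forall>A\<in>\<A>. ((\<lambda>l. measure (distr M borel (\<lambda>\<omega>. noise_product \<xi> k l \<omega> + \<eta> (l - 1) \<omega>0)) A)
      \<longlongrightarrow> measure (distr M borel (\<eta> k)) A) at_bot"
      by (subst AE_ball_countable) auto
    then show ?thesis
    proof eventually_elim
      case (elim \<omega>0)
      show ?case unfolding cond_E1_def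
      proof (intro allI impI)
        fix k :: int assume k: "k \<le> 0"
        note [measurable] = solution_measurable(1)[OF sol k] measurable_noise_product[OF sol k]
        show "weakly_converges (\<lambda>l. distr M borel (\<lambda>\<omega>. noise_product \<xi> k l \<omega> + \<eta> (l - 1) \<omega>0)) (distr M borel (\<eta> k)) at_bot"
        proof (rule weak)
          show "prob_space (distr M borel (\<lambda>\<omega>. noise_product \<xi> k l \<omega> + \<eta> (l - 1) \<omega>0))" for l
            by (rule prob_space_distr) measurable
          show "prob_space (distr M borel (\<eta> k))" by (rule prob_space_distr) measurable
        qed (use elim k in auto)
      qed
    qed
  qed
qed

section \<open>Haar measure on a compact subgroup\<close>

lemma nested_closed_nonempty:
  fixes C :: "nat \<Rightarrow> 'a::topological_space set"
  assumes "compact (UNIV :: 'a set)" "\<And>n. closed (C n)" "\<And>n. C n \<noteq> {}" "decseq C"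
  shows "(\<Inter>n. C n) \<noteq> {}"
proof -
  have "UNIV \<inter> (\<Inter>n\<in>UNIV. C n) \<noteq> {}"
  proof (rule compact_imp_fip_image[OF assms(1,2)])
    fix I :: "nat set" assume "finite I"
    then have "C (Max (insert 0 I)) \<subseteq> (\<Inter>n\<in>I. C n)"
      by (intro INT_greatest decseqD[OF assms(4)] Max_ge) auto
    with assms(3)[of "Max (insert 0 I)"] show "UNIV \<inter> (\<Inter>n\<in>I. C n) \<noteq> {}" by blast
  qed
  then show ?thesis by simp
qed

text \<open>
  Haar measure is the law of \<open>x\<^sup>-\<^sup>1 s(x)\<close> under any right \<open>H\<close>-invariant law, where \<open>s\<close> selects
  measurably a point of each coset \<open>xH\<close>. The selection: intersecting a compact set successively with the members of a sequence of closed sets, as long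
  as the result is nonempty, selects a single point when the sequence separates points.
\<close>

primrec refine :: "(nat \<Rightarrow> 'a set) \<Rightarrow> nat \<Rightarrow> 'a set \<Rightarrow> 'a set" where
  "refine K 0 C = C"
| "refine K (Suc n) C = (if refine K n C \<inter> K n = {} then refine K n C else refine K n C \<inter> K n)"

lemma refine_nonempty: "C \<noteq> {} \<Longrightarrow> refine K n C \<noteq> {}"
  by (induction n) auto

lemma decseq_refine: "decseq (\<lambda>n. refine K n C)"
  by (rule decseq_SucI) auto

lemma closed_refine: "(\<And>n. closed (K n)) \<Longrightarrow> closed C \<Longrightarrow> closed (refine K n C)"
  by (induction n) auto

lemma refine_singleton:
  assumes "compact (UNIV :: 'a::topological_space set)" "\<And>n. closed (K n)" "closed C" "C \<noteq> {}"
    and sep: "\<And>x y :: 'a. x \<noteq> y \<Longrightarrow> \<exists>n. x \<in> K n \<and> y \<notin> K n"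
  shows "\<exists>z. (\<Inter>n. refine K n C) = {z}"
proof -
  define A where "A = (\<Inter>n. refine K n C)"
  have "A \<noteq> {}" unfolding A_def
    by (intro nested_closed_nonempty closed_refine refine_nonempty decseq_refine assms)
  then obtain z where z: "z \<in> A" by blast
  have A: "x \<in> refine K n C" if "x \<in> A" for x n
    using that unfolding A_def by (rule INT_D) simp
  have "y = z" if y: "y \<in> A" for y
  proof (rule ccontr)
    \<comment> \<open>With \<open>z\<close> in \<open>K n\<close>, stage \<open>n\<close> meets
      \<open>K n\<close>; the next stage is therefore contained in \<open>K n\<close> and excludes
      \<open>y\<close>.\<close>
    assume "y \<noteq> z"
    then obtain n where n: "z \<in> K n" "y \<notin> K n" using sep[of z y] by auto
    with A[OF z, of n] A[OF y, of "Suc n"] show False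
      by (cases "refine K n C \<inter> K n = {}") auto
  qed
  with z have "A = {z}" by blast
  then show ?thesis unfolding A_def ..
qed

lemma lcoset_right_translate:
  assumes "compact_subgroup H" "h \<in> H"
  shows "lcoset (x + h) H = lcoset x H"
proof (intro equalityI subsetI)
  fix y assume "y \<in> lcoset (x + h) H"
  then obtain h' where "h' \<in> H" "y = x + (h + h')" by (auto simp: lcoset_def add.assoc)
  with assms show "y \<in> lcoset x H" by (auto simp: lcoset_def compact_subgroup_def)
next
  fix y assume "y \<in> lcoset x H"
  then obtain h' where "h' \<in> H" "y = x + h + (- h + h')" by (auto simp: lcoset_def add.assoc)
  with assms show "y \<in> lcoset (x + h) H" unfolding lcoset_def compact_subgroup_def by blast
qed

text \<open>The selected point is computed from the coset alone, hence its invariance. Measurability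
  reduces to the sets of \<open>x\<close> for which a given refinement stage of the coset meets a
  given closed set.\<close>

lemma borel_coset_selector:
  fixes H :: "'a::{topological_group_add, t2_space, second_countable_topology} set"
  assumes cpt: "compact (UNIV :: 'a set)" and H: "compact_subgroup H"
  obtains s where "s \<in> borel_measurable borel" "\<And>x. s x \<in> lcoset x H"
    "\<And>x h. h \<in> H \<Longrightarrow> s (x + h) = s x"
proof -
  obtain B :: "'a set set" where B: "countable B" "topological_basis B"
    using ex_countable_basis by blast
  have Bne: "B \<noteq> {}" using topological_basisE[OF B(2) open_UNIV, of undefined] by blast
  \<comment> \<open>Complements of basis sets are closed, and they separate points because points
    are closed.\<close>
  define K where "K n = - from_nat_into B n" for n
  have K: "closed (K n)" for n
    using topological_basis_open[OF B(2)] from_nat_into[OF Bne] by (auto simp: K_def)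
  have sep: "\<exists>n. x \<in> K n \<and> y \<notin> K n" if "x \<noteq> y" for x y
  proof -
    have "open (- {x})" "y \<in> - {x}" using that by auto
    then obtain b where b: "b \<in> B" "y \<in> b" "b \<subseteq> - {x}"
      using topological_basisE[OF B(2)] by metis
    then obtain n where "from_nat_into B n = b" using from_nat_into_surj[OF B(1)] by blast
    with b show ?thesis by (auto simp: K_def intro!: exI[of _ n])
  qed
  have cH: "compact H" and H0: "0 \<in> H" and Hneg: "\<And>h. h \<in> H \<Longrightarrow> - h \<in> H"
    using H by (auto simp: compact_subgroup_def)
  let ?L = "\<lambda>x. lcoset x H"
  have L: "closed (?L x)" "?L x \<noteq> {}" for x
  proof -
    have "compact (?L x)" unfolding lcoset_def
      by (rule compact_continuous_image[OF _ cH]) (intro continuous_intros)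
    then show "closed (?L x)" by (rule compact_imp_closed)
    show "?L x \<noteq> {}" using H0 by (auto simp: lcoset_def)
  qed
  define s where "s x = (THE z. (\<Inter>n. refine K n (?L x)) = {z})" for x
  have s: "(\<Inter>n. refine K n (?L x)) = {s x}" for x
  proof -
    obtain z where "(\<Inter>n. refine K n (?L x)) = {z}"
      using refine_singleton[where K=K and C="?L x", OF cpt K L sep] by (rule exE)
    then show ?thesis unfolding s_def by simp
  qed
  have s_in: "s x \<in> refine K n (?L x)" for n x
    using s[of x] INT_D[of "s x" "\<lambda>n. refine K n (?L x)" UNIV n] by simp
  have s_eq: "z = s x" if "\<And>n. z \<in> refine K n (?L x)" for z x
    using s[of x] INT_I[of UNIV z "\<lambda>n. refine K n (?L x)"] that by simp
  \<comment> \<open>Induction over the stages: initially the set is the product of \<open>D\<close>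
    and \<open>H\<close>, which is compact; each further stage is a Boolean combination of sets of
    the same kind for closed \<open>D\<close>.\<close>
  have hit: "{x. refine K n (?L x) \<inter> D \<noteq> {}} \<in> sets borel" if "closed D" for n D
    using that
  proof (induction n arbitrary: D)
    case 0
    have "{x. ?L x \<inter> D \<noteq> {}} = (\<lambda>z. fst z + snd z) ` (D \<times> H)"
    proof (intro equalityI subsetI)
      fix x assume "x \<in> {x. ?L x \<inter> D \<noteq> {}}"
      then obtain h where h: "h \<in> H" "x + h \<in> D" by (auto simp: lcoset_def)
      then have "x = fst (x + h, - h) + snd (x + h, - h)" by (simp add: add.assoc)
      then show "x \<in> (\<lambda>z. fst z + snd z) ` (D \<times> H)"
        by (rule image_eqI) (use h Hneg in simp)
    next
      fix x assume "x \<in> (\<lambda>z. fst z + snd z) ` (D \<times> H)"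
      then obtain d h where dh: "d \<in> D" "h \<in> H" "x = d + h" by auto
      then have "d = x + - h" by (simp add: add.assoc)
      with dh Hneg have "d \<in> ?L x" unfolding lcoset_def by blast
      with dh show "x \<in> {x. ?L x \<inter> D \<noteq> {}}" by blast
    qed
    moreover have "compact ((\<lambda>z. fst z + snd z) ` (D \<times> H))"
      using compact_Int_closed[OF cpt 0] cH
      by (intro compact_continuous_image compact_Times continuous_intros) auto
    ultimately show ?case by (simp add: borel_closed compact_imp_closed)
  next
    case (Suc n)
    have "{x. refine K (Suc n) (?L x) \<inter> D \<noteq> {}} =
      {x. refine K n (?L x) \<inter> (K n \<inter> D) \<noteq> {}} \<union>
      ({x. refine K n (?L x) \<inter> D \<noteq> {}} - {x. refine K n (?L x) \<inter> K n \<noteq> {}})"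
      unfolding refine.simps by (intro set_eqI) (simp add: Int_assoc, blast)
    also have "\<dots> \<in> sets borel"
      using Suc.IH[OF closed_Int[OF K Suc.prems], of n] Suc.IH[OF Suc.prems] Suc.IH[OF K, of n] by blast
    finally show ?case .
  qed
  have "s \<in> borel_measurable borel"
  proof (rule borel_measurableI)
    fix U :: "'a set" assume U: "open U"
    have D: "closed (- U)" using U by (simp add: closed_def)
    \<comment> \<open>If every stage meets the closed set \<open>- U\<close>, then so does their
      intersection, by compactness; and that intersection is the selected point.\<close>
    have "s -` (- U) = (\<Inter>n. {x. refine K n (?L x) \<inter> - U \<noteq> {}})"
    proof (intro equalityI subsetI)
      fix x assume "x \<in> s -` (- U)"
      then show "x \<in> (\<Inter>n. {x. refine K n (?L x) \<inter> - U \<noteq> {}})" using s_in[of x] by blast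
    next
      fix x assume x: "x \<in> (\<Inter>n. {x. refine K n (?L x) \<inter> - U \<noteq> {}})"
      have "(\<Inter>n. refine K n (?L x) \<inter> - U) \<noteq> {}"
        using x decseq_refine[of K "?L x"]
        by (intro nested_closed_nonempty cpt closed_Int closed_refine K L D) (auto simp: decseq_def)
      then obtain z where z: "\<And>n. z \<in> refine K n (?L x)" "z \<notin> U" by blast
      then show "x \<in> s -` (- U)" using s_eq[OF z(1)] by simp
    qed
    then have "s -` (- U) \<in> sets borel" using hit[OF D] by auto
    then have "- (s -` (- U)) \<in> sets borel" by (metis borel_comp)
    then show "s -` U \<inter> space borel \<in> sets borel" by (simp add: vimage_Compl)
  qed
  moreover have "s x \<in> ?L x" for x
    using s_in[of x 0] by simp
  moreover have "s (x + h) = s x" if "h \<in> H" for x h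
    using lcoset_right_translate[OF H that] by (simp add: s_def)
  ultimately show thesis by (rule that)
qed

lemma normalized_haar_exists:
  fixes H :: "'a::{topological_group_add, t2_space, second_countable_topology} set"
  assumes cpt: "compact (UNIV :: 'a set)" and H: "compact_subgroup H"
    and P: "prob_space P" "sets P = sets borel"
    and inv: "\<And>h. h \<in> H \<Longrightarrow> distr P borel (\<lambda>x. x + h) = P"
  shows "\<exists>\<nu>. normalized_haar H \<nu>"
proof -
  interpret P: prob_space P by fact
  obtain s where s: "s \<in> borel_measurable borel" "\<And>x. s x \<in> lcoset x H"
      "\<And>x h. h \<in> H \<Longrightarrow> s (x + h) = s x"
    using borel_coset_selector[OF cpt H] by metis
  have Hcl: "closed H" and Hneg: "\<And>h. h \<in> H \<Longrightarrow> - h \<in> H"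
    using H compact_imp_closed by (auto simp: compact_subgroup_def)
  define t where "t x = - x + s x" for x
  have t: "t \<in> borel_measurable borel"
    unfolding t_def[abs_def] by (intro borel_measurable_add borel_measurable_group_uminus s(1)) auto
  have t': "t \<in> borel_measurable P" using t P(2) by (simp cong: measurable_cong_sets)
  have tH: "t x \<in> H" for x
    using s(2)[of x] by (auto simp: t_def lcoset_def add.assoc[symmetric])
  define \<nu> where "\<nu> = distr P borel t"
  have "emeasure \<nu> H = 1"
  proof -
    have "t -` H \<inter> space P = space P" using tH by auto
    then show ?thesis
      using t' Hcl by (simp add: \<nu>_def emeasure_distr P.emeasure_space_1)
  qed
  moreover have "distr \<nu> borel (\<lambda>x. h + x) = \<nu>" if h: "h \<in> H" for h
  proof -
    \<comment> \<open>Since \<open>s\<close> is constant on cosets, right translation of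
      \<open>x\<close> becomes left translation of \<open>t x\<close>. This converts right
      invariance of \<open>P\<close> into left invariance of \<open>\<nu>\<close>.\<close>
    have "t (x + - h) = h + t x" for x
      using s(3)[OF Hneg[OF h]] by (simp add: t_def minus_add add.assoc[symmetric])
    then have "(\<lambda>x. h + x) \<circ> t = t \<circ> (\<lambda>x. x + - h)" by auto
    moreover have tr: "(\<lambda>x. h + x) \<in> borel_measurable borel" "(\<lambda>x. x + - h) \<in> borel_measurable P"
      using measurable_ident_sets[OF P(2)] by (intro borel_measurable_add; simp)+
    ultimately have "distr \<nu> borel (\<lambda>x. h + x) = distr P borel (t \<circ> (\<lambda>x. x + - h))"
      unfolding \<nu>_def by (simp only: distr_distr[OF _ t'])
    also have "\<dots> = distr (distr P borel (\<lambda>x. x + - h)) borel t"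
      by (rule distr_distr[OF t tr(2), symmetric])
    also have "\<dots> = \<nu>" by (simp only: inv[OF Hneg[OF h]] \<nu>_def)
    finally show ?thesis .
  qed
  ultimately show ?thesis
    using P.prob_space_distr[OF t'] by (intro exI[of _ \<nu>]) (auto simp: normalized_haar_def \<nu>_def)
qed

text \<open>For \<open>h\<close> in \<open>H\<close>, both \<open>H'\<close> and its preimage under
  left translation by \<open>h\<close> have full measure, so they share a point \<open>x\<close>;
  then \<open>h = (h + x) + - x\<close> lies in \<open>H'\<close>.\<close>

lemma normalized_haar_subgroup_subset:
  fixes H H' :: "'a::{topological_group_add, t2_space, second_countable_topology} set"
  assumes H: "compact_subgroup H" "normalized_haar H \<nu>" and H': "compact_subgroup H'" "normalized_haar H' \<nu>"
  shows "H \<subseteq> H'"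
proof
  fix h assume h: "h \<in> H"
  interpret prob_space \<nu> using H by (simp add: normalized_haar_def)
  have sets: "sets \<nu> = sets borel" and sp: "space \<nu> = UNIV"
    using H(2) sets_eq_imp_space_eq[of \<nu> borel] by (auto simp: normalized_haar_def)
  have cl: "closed H'" using H'(1) compact_imp_closed by (auto simp: compact_subgroup_def)
  have m: "(\<lambda>x. h + x) \<in> borel_measurable \<nu>"
    using sets by (intro borel_measurable_add) (auto simp: measurable_ident_sets)
  have "emeasure \<nu> H' = emeasure (distr \<nu> borel (\<lambda>x. h + x)) H'"
    using H(2) h by (simp add: normalized_haar_def)
  also have "\<dots> = emeasure \<nu> ((\<lambda>x. h + x) -` H')"
    using m cl sp by (subst emeasure_distr) auto
  finally have "emeasure \<nu> ((\<lambda>x. h + x) -` H') = 1" using H'(2) by (simp add: normalized_haar_def)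
  then have "AE x in \<nu>. x \<in> (\<lambda>x. h + x) -` H'"
    using measurable_sets[OF m, of H'] cl sp by (subst prob_eq_1[symmetric]) (auto simp: measure_def)
  moreover have "AE x in \<nu>. x \<in> H'"
    using H'(2) cl sets by (subst prob_eq_1[symmetric]) (auto simp: measure_def normalized_haar_def)
  ultimately have "AE x in \<nu>. \<exists>x. h + x \<in> H' \<and> x \<in> H'" by eventually_elim auto
  then obtain x where x: "h + x \<in> H'" "x \<in> H'" using not_AE_zero_E by auto
  then have "h + x + - x \<in> H'" using H'(1) unfolding compact_subgroup_def by blast
  then show "h \<in> H'" by (simp add: add.assoc)
qed

lemma compact_subgroup_conj:
  fixes H :: "'a::topological_group_add set"
  assumes "compact_subgroup H"
  shows "compact_subgroup ((\<lambda>h. - g + h + g) ` H)"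
  unfolding compact_subgroup_def
proof (intro conjI ballI)
  show "compact ((\<lambda>h. - g + h + g) ` H)"
    using assms by (intro compact_continuous_image continuous_intros) (auto simp: compact_subgroup_def)
  show "0 \<in> (\<lambda>h. - g + h + g) ` H"
    using assms by (intro image_eqI[of _ _ 0]) (auto simp: compact_subgroup_def)
next
  fix x y assume "x \<in> (\<lambda>h. - g + h + g) ` H" "y \<in> (\<lambda>h. - g + h + g) ` H"
  then obtain a b where ab: "a \<in> H" "b \<in> H" "x = - g + a + g" "y = - g + b + g" by auto
  have "x + y = - g + (a + b) + g" unfolding ab by (metis add.assoc add_minus_cancel)
  then show "x + y \<in> (\<lambda>h. - g + h + g) ` H"
    using assms ab by (auto simp: compact_subgroup_def)
next
  fix x assume "x \<in> (\<lambda>h. - g + h + g) ` H"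
  then obtain a where a: "a \<in> H" "x = - g + a + g" by auto
  have "- x = - g + - a + g" unfolding a by (simp add: minus_add add.assoc)
  then show "- x \<in> (\<lambda>h. - g + h + g) ` H"
    by (rule image_eqI) (use assms a in \<open>simp add: compact_subgroup_def\<close>)
qed

lemma normalized_haar_conj:
  fixes H :: "'a::{topological_group_add, t2_space, second_countable_topology} set"
  assumes H: "compact_subgroup H" and \<nu>: "normalized_haar H \<nu>"
  shows "normalized_haar ((\<lambda>h. - g + h + g) ` H) (distr \<nu> borel (\<lambda>x. - g + x + g))"
proof -
  interpret prob_space \<nu> using \<nu> by (simp add: normalized_haar_def)
  let ?c = "\<lambda>x. - g + x + g" and ?H = "(\<lambda>h. - g + h + g) ` H"
  have sets: "sets \<nu> = sets borel" and sp: "space \<nu> = UNIV"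
    using \<nu> sets_eq_imp_space_eq[of \<nu> borel] by (auto simp: normalized_haar_def)
  have c: "?c \<in> borel_measurable borel" by (intro borel_measurable_add) auto
  then have c': "?c \<in> borel_measurable \<nu>" using sets by (simp cong: measurable_cong_sets)
  have "compact ?H"
    using compact_subgroup_conj[OF H] unfolding compact_subgroup_def by blast
  then have "closed ?H" by (rule compact_imp_closed)
  moreover have "?c -` ?H = H"
    by (auto simp: add.assoc)
  ultimately have "emeasure (distr \<nu> borel ?c) ?H = 1"
    using c' sp \<nu> by (simp add: emeasure_distr normalized_haar_def)
  moreover have "distr (distr \<nu> borel ?c) borel (\<lambda>x. ?c h + x) = distr \<nu> borel ?c" if h: "h \<in> H" for h
  proof -
    have tr: "(\<lambda>x. a + x) \<in> borel_measurable borel" for a :: 'a by (intro borel_measurable_add) auto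
    have eq: "(\<lambda>x. ?c h + x) \<circ> ?c = ?c \<circ> (\<lambda>x. h + x)"
      by (auto simp: fun_eq_iff) (metis add.assoc add_minus_cancel)
    have "distr (distr \<nu> borel ?c) borel (\<lambda>x. ?c h + x) = distr \<nu> borel (?c \<circ> (\<lambda>x. h + x))"
      by (simp only: distr_distr[OF tr c'] eq)
    also have "\<dots> = distr (distr \<nu> borel (\<lambda>x. h + x)) borel ?c"
      using c tr sets by (subst distr_distr) (auto cong: measurable_cong_sets)
    also have "\<dots> = distr \<nu> borel ?c" using \<nu> h by (simp add: normalized_haar_def)
    finally show ?thesis .
  qed
  ultimately show ?thesis
    using prob_space_distr[OF c'] by (auto simp: normalized_haar_def)
qed

section \<open>Change of the starting sequence and attraction to the stabilizer\<close>

lemma weakly_converges_distr_pair: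
  fixes c :: "'b::topological_space \<times> 'a::topological_space \<Rightarrow> 'c::topological_space"
  assumes cpt: "compact (UNIV :: 'a set)" and c: "continuous_on UNIV c"
    and P: "\<And>i. prob_space (P i)" "\<And>i. sets (P i) = sets borel" and Q: "sets Q = sets borel"
    and w: "weakly_converges P Q F" and g: "(g \<longlongrightarrow> g0) F"
  shows "weakly_converges (\<lambda>i. distr (P i) borel (\<lambda>x. c (g i, x))) (distr Q borel (\<lambda>x. c (g0, x))) F"
  unfolding weakly_converges_def
proof (intro allI impI)
  fix f :: "'c \<Rightarrow> real" assume f: "continuous_on UNIV f \<and> bounded (range f)"
  have "continuous_on UNIV (\<lambda>x. c (y, x))" for y
    by (rule continuous_on_compose2[OF c]) (auto intro!: continuous_intros)
  then have "(\<lambda>x. c (y, x)) \<in> borel_measurable R" if "sets R = sets borel" for y R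
    using that by (simp add: borel_measurable_continuous_onI cong: measurable_cong_sets)
  then have "integral\<^sup>L (distr R borel (\<lambda>x. c (y, x))) f = (\<integral>x. f (c (y, x)) \<partial>R)"
    if "sets R = sets borel" for y R
    using f that by (intro integral_distr) (auto intro: borel_measurable_continuous_onI)
  moreover have "((\<lambda>i. \<integral>x. f (c (g i, x)) \<partial>P i) \<longlongrightarrow> (\<integral>x. f (c (g0, x)) \<partial>Q)) F"
    using f by (intro weakly_converges_integral_pair[OF cpt _ P w g, where f="\<lambda>z. f (c z)"])
      (auto intro: continuous_on_compose2[OF _ c])
  ultimately show "((\<lambda>i. integral\<^sup>L (distr (P i) borel (\<lambda>x. c (g i, x))) f) \<longlongrightarrow>
      integral\<^sup>L (distr Q borel (\<lambda>x. c (g0, x))) f) F"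
    using P(2) Q by simp
qed

text \<open>Write \<open>\<beta>\<close> as \<open>\<alpha> + (- \<alpha> + \<beta>)\<close>: the
  first summand is handled by (E1), and the second is a right translation that converges to
  \<open>g\<close>.\<close>

lemma weakly_converges_noise_shift:
  fixes \<mu> :: "int \<Rightarrow> 'a::{topological_group_add, t2_space, second_countable_topology} measure"
  assumes cpt: "compact (UNIV :: 'a set)" and sol: "solution \<mu> M \<eta> \<xi>" and E1: "cond_E1 M \<eta> \<xi> \<alpha>"
    and k: "k \<le> 0" and l: "filterlim l at_bot F" and g: "((\<lambda>j. - \<alpha> (l j) + \<beta> (l j)) \<longlongrightarrow> g) F"
  shows "weakly_converges (\<lambda>j. distr M borel (\<lambda>\<omega>. noise_product \<xi> k (l j) \<omega> + \<beta> (l j)))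
    (distr M borel (\<lambda>\<omega>. \<eta> k \<omega> + g)) F"
proof -
  interpret prob_space M by (rule solution_prob_space[OF sol])
  note meas [measurable] = solution_measurable(1)[OF sol k] measurable_noise_product[OF sol k]
  let ?P = "\<lambda>l. distr M borel (\<lambda>\<omega>. noise_product \<xi> k l \<omega> + \<alpha> l)" and ?Q = "distr M borel (\<eta> k)"
  let ?c = "\<lambda>(y, x). x + y :: 'a"
  have tr: "(\<lambda>x. x + a) \<in> borel_measurable borel" for a :: 'a by measurable
  have "weakly_converges ?P ?Q at_bot" using E1 k by (simp add: cond_E1_def)
  then have "weakly_converges (\<lambda>j. ?P (l j)) ?Q F" by (rule weakly_converges_compose[OF _ l])
  then have "weakly_converges (\<lambda>j. distr (?P (l j)) borel (\<lambda>x. ?c (- \<alpha> (l j) + \<beta> (l j), x)))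
    (distr ?Q borel (\<lambda>x. ?c (g, x))) F"
    by (intro weakly_converges_distr_pair cpt g)
       (auto simp: split_beta' intro!: continuous_intros prob_space_distr)
  moreover have "distr (?P l) borel (\<lambda>x. ?c (- \<alpha> l + \<beta> l, x)) = distr M borel (\<lambda>\<omega>. noise_product \<xi> k l \<omega> + \<beta> l)" for l
    by (simp add: distr_distr[OF tr] comp_def add.assoc)
  moreover have "distr ?Q borel (\<lambda>x. ?c (g, x)) = distr M borel (\<lambda>\<omega>. \<eta> k \<omega> + g)"
    by (simp add: distr_distr[OF tr] comp_def)
  ultimately show ?thesis by simp
qed

text \<open>Closedness is the only analytic point: testing against continuous \<open>f\<close>
  writes the stabilizer as an intersection of closed sets, since translated integrals depend
  continuously on \<open>h\<close>.\<close>

lemma compact_subgroup_stabilizer: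
  fixes P :: "'i \<Rightarrow> 'a::{topological_group_add, t2_space, second_countable_topology} measure"
  assumes cpt: "compact (UNIV :: 'a set)"
    and P: "\<And>i. i \<in> I \<Longrightarrow> prob_space (P i)" "\<And>i. i \<in> I \<Longrightarrow> sets (P i) = sets borel"
  shows "compact_subgroup {h. \<forall>i\<in>I. distr (P i) borel (\<lambda>x. x + h) = P i}" (is "compact_subgroup ?H")
proof -
  have tr: "(\<lambda>x. x + a) \<in> borel_measurable borel" for a :: 'a by (intro borel_measurable_add) auto
  have tr': "(\<lambda>x. x + a) \<in> borel_measurable (P i)" if "i \<in> I" for a i
    using tr P(2)[OF that] by (simp cong: measurable_cong_sets)
  have comp: "distr (distr (P i) borel (\<lambda>x. x + a)) borel (\<lambda>x. x + b) = distr (P i) borel (\<lambda>x. x + (a + b))"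
    if "i \<in> I" for a b i
    by (simp add: distr_distr[OF tr tr'[OF that]] comp_def add.assoc)
  have zero: "distr (P i) borel (\<lambda>x. x + 0) = P i" if "i \<in> I" for i
    using distr_id2[OF P(2)[OF that, symmetric]] by simp
  have eq: "?H = (\<Inter>i\<in>I. \<Inter>f\<in>{f :: 'a \<Rightarrow> real. continuous_on UNIV f}.
      {h. (\<integral>x. f (x + h) \<partial>P i) = integral\<^sup>L (P i) f})" (is "_ = ?R")
  proof (intro equalityI subsetI)
    fix h assume h: "h \<in> ?H"
    have "(\<integral>x. f (x + h) \<partial>P i) = integral\<^sup>L (P i) f" if i: "i \<in> I" and f: "continuous_on UNIV f"
      for i and f :: "'a \<Rightarrow> real"
      using integral_distr[OF tr'[OF i] borel_measurable_continuous_onI[OF f], of h] h i by simp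
    then show "h \<in> ?R" by simp
  next
    fix h assume h: "h \<in> ?R"
    have "distr (P i) borel (\<lambda>x. x + h) = P i" if i: "i \<in> I" for i
    proof (rule borel_measure_eqI_continuous[OF cpt])
      fix f :: "'a \<Rightarrow> real" assume f: "continuous_on UNIV f"
      show "integral\<^sup>L (distr (P i) borel (\<lambda>x. x + h)) f = integral\<^sup>L (P i) f"
        using integral_distr[OF tr'[OF i] borel_measurable_continuous_onI[OF f], of h] h i f by simp
    qed (use P i prob_space.prob_space_distr[OF P(1)[OF i] tr'[OF i]] in auto)
    then show "h \<in> ?H" by simp
  qed
  have "closed ?H" unfolding eq
  proof (intro closed_INT ballI)
    fix i f assume i: "i \<in> I" and "f \<in> {f :: 'a \<Rightarrow> real. continuous_on UNIV f}"
    then have f: "continuous_on UNIV f" by simp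
    have "continuous_on UNIV (\<lambda>z::'a \<times> 'a. f (snd z + fst z))"
      by (rule continuous_on_compose2[OF f]) (auto intro!: continuous_intros)
    from continuous_on_integral_pair[OF cpt this P[OF i]]
    show "closed {h. (\<integral>x. f (x + h) \<partial>P i) = integral\<^sup>L (P i) f}"
      by (intro closed_Collect_eq) (auto intro: continuous_intros)
  qed
  then have "compact ?H" using compact_Int_closed[OF cpt] by simp
  moreover have "0 \<in> ?H" using zero by simp
  moreover have "g + h \<in> ?H" if "g \<in> ?H" "h \<in> ?H" for g h
    using that by (simp flip: comp)
  moreover have "- h \<in> ?H" if h: "h \<in> ?H" for h
  proof -
    have "distr (P i) borel (\<lambda>x. x + - h) = P i" if i: "i \<in> I" for i
      using comp[OF i, of h "- h"] h i zero[OF i] by simp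
    then show ?thesis by simp
  qed
  ultimately show ?thesis unfolding compact_subgroup_def by blast
qed

text \<open>If the differences left \<open>V\<close> infinitely often, a subsequence outside
  \<open>V\<close> would converge to some \<open>g\<close>. The laws along it tend both to that of
  \<open>\<eta> k\<close> translated by \<open>g\<close> and to that of \<open>\<eta> k\<close>, so
  \<open>g\<close> is in the stabilizer, hence in the open set \<open>V\<close>.\<close>

lemma eventually_diff_in_open:
  fixes \<mu> :: "int \<Rightarrow> 'a::{topological_group_add, t2_space, second_countable_topology} measure"
  assumes cpt: "compact (UNIV :: 'a set)" and sol: "solution \<mu> M \<eta> \<xi>"
    and E1: "cond_E1 M \<eta> \<xi> \<alpha>" "cond_E1 M \<eta> \<xi> \<beta>" and V: "open V"
    and sub: "{h. \<forall>k\<in>{..0}. distr (distr M borel (\<eta> k)) borel (\<lambda>x. x + h) = distr M borel (\<eta> k)} \<subseteq> V"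
  shows "\<forall>\<^sub>F l in at_bot. - \<alpha> l + \<beta> l \<in> V"
proof (rule ccontr)
  assume "\<not> ?thesis"
  then have "\<forall>N. \<exists>l\<le>N. - \<alpha> l + \<beta> l \<notin> V" by (simp add: eventually_at_bot_linorder)
  then have "\<forall>j::nat. \<exists>l. l \<le> - int j \<and> - \<alpha> l + \<beta> l \<notin> V" by blast
  from choice[OF this] obtain l where l: "\<And>j. l j \<le> - int j" "\<And>j. - \<alpha> (l j) + \<beta> (l j) \<notin> V" by auto
  have "seq_compact (UNIV :: 'a set)" by (rule compact_imp_seq_compact[OF cpt])
  then obtain g r where r: "strict_mono r" "((\<lambda>j. - \<alpha> (l j) + \<beta> (l j)) \<circ> r) \<longlonglongrightarrow> g"
    unfolding seq_compact_def by (metis UNIV_I)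
  have lr: "filterlim (\<lambda>j. l (r j)) at_bot sequentially"
    unfolding filterlim_at_bot eventually_sequentially
  proof
    fix Z :: int
    have "l (r j) \<le> Z" if "nat (- Z) \<le> j" for j
      using l(1)[of "r j"] seq_suble[OF r(1), of j] that by linarith
    then show "\<exists>N. \<forall>j\<ge>N. l (r j) \<le> Z" by blast
  qed
  have rg: "(\<lambda>j. - \<alpha> (l (r j)) + \<beta> (l (r j))) \<longlonglongrightarrow> g" using r(2) by (simp add: comp_def)
  interpret prob_space M by (rule solution_prob_space[OF sol])
  have "distr M borel (\<lambda>\<omega>. \<eta> k \<omega> + g) = distr M borel (\<eta> k)" if k: "k \<le> 0" for k
  proof (rule weakly_converges_unique[OF cpt])
    show "weakly_converges (\<lambda>j. distr M borel (\<lambda>\<omega>. noise_product \<xi> k (l (r j)) \<omega> + \<beta> (l (r j))))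
      (distr M borel (\<lambda>\<omega>. \<eta> k \<omega> + g)) sequentially"
      by (rule weakly_converges_noise_shift[OF cpt sol E1(1) k lr rg])
    show "weakly_converges (\<lambda>j. distr M borel (\<lambda>\<omega>. noise_product \<xi> k (l (r j)) \<omega> + \<beta> (l (r j))))
      (distr M borel (\<eta> k)) sequentially"
      using E1(2) k weakly_converges_compose[OF _ lr] by (auto simp: cond_E1_def)
    note [measurable] = solution_measurable(1)[OF sol k]
    show "prob_space (distr M borel (\<lambda>\<omega>. \<eta> k \<omega> + g))" "prob_space (distr M borel (\<eta> k))"
      by (rule prob_space_distr, measurable)+
  qed auto
  moreover have "distr (distr M borel (\<eta> k)) borel (\<lambda>x. x + g) = distr M borel (\<lambda>\<omega>. \<eta> k \<omega> + g)" if "k \<le> 0" for k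
    using solution_measurable(1)[OF sol that] by (subst distr_distr) (auto simp: comp_def intro!: borel_measurable_add)
  ultimately have "g \<in> V" using sub by auto
  then have "\<forall>\<^sub>F j in sequentially. - \<alpha> (l (r j)) + \<beta> (l (r j)) \<in> V"
    using rg V by (simp add: tendsto_def)
  then show False using l(2) by (simp add: eventually_sequentially)
qed

text \<open>Right \<open>H\<close>-invariance of the law of \<open>Y l\<close> permits replacing
  \<open>f\<close> by its average \<open>F\<close> over \<open>H\<close>. \<open>F\<close> is
  continuous and equals the Haar integral of \<open>f\<close> everywhere on \<open>H\<close>, and
  \<open>Y l\<close> approaches \<open>H\<close>; dominated convergence concludes.\<close>

lemma weakly_converges_haar:
  fixes H :: "'a::{topological_group_add, t2_space, second_countable_topology} set"
  assumes cpt: "compact (UNIV :: 'a set)" and H: "compact_subgroup H" and \<nu>: "normalized_haar H \<nu>"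
    and M: "prob_space M" and Y: "\<And>l::int. l \<le> 0 \<Longrightarrow> Y l \<in> borel_measurable M"
    and inv: "\<And>l h. l \<le> 0 \<Longrightarrow> h \<in> H \<Longrightarrow> distr M borel (\<lambda>\<omega>. Y l \<omega> + h) = distr M borel (Y l)"
    and near: "AE \<omega> in M. \<forall>V. open V \<and> H \<subseteq> V \<longrightarrow> (\<forall>\<^sub>F l in at_bot. Y l \<omega> \<in> V)"
  shows "weakly_converges (\<lambda>l. distr M borel (Y l)) \<nu> at_bot"
  unfolding weakly_converges_def
proof (intro allI impI)
  fix f :: "'a \<Rightarrow> real" assume "continuous_on UNIV f \<and> bounded (range f)"
  then have f: "continuous_on UNIV f" "bounded (range f)" by auto
  interpret M: prob_space M by fact
  interpret \<nu>: prob_space \<nu> using \<nu> by (simp add: normalized_haar_def)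
  interpret M\<nu>: pair_prob_space M \<nu> ..
  have sets: "sets \<nu> = sets borel" and \<nu>H: "emeasure \<nu> H = 1"
    and \<nu>_inv: "\<And>h. h \<in> H \<Longrightarrow> distr \<nu> borel (\<lambda>x. h + x) = \<nu>"
    using \<nu> by (auto simp: normalized_haar_def)
  have fm [measurable]: "f \<in> borel_measurable borel" by (rule borel_measurable_continuous_onI[OF f(1)])
  have [measurable]: "(\<lambda>x. x) \<in> borel_measurable \<nu>" using sets by (simp add: measurable_ident_sets)
  obtain c where c: "\<And>x. \<bar>f x\<bar> \<le> c" using f(2) by (auto simp: bounded_iff)
  define F where "F x = (\<integral>h. f (x + h) \<partial>\<nu>)" for x
  have "continuous_on UNIV (\<lambda>z::'a \<times> 'a. f (fst z + snd z))"
    by (rule continuous_on_compose2[OF f(1)]) (auto intro!: continuous_intros)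
  from continuous_on_integral_pair[OF cpt this \<nu>.prob_space_axioms sets]
  have F: "continuous_on UNIV F" by (simp add: F_def[abs_def])
  then have [measurable]: "F \<in> borel_measurable borel" by (rule borel_measurable_continuous_onI)
  have F_H: "F h = integral\<^sup>L \<nu> f" if "h \<in> H" for h
  proof -
    have "integral\<^sup>L \<nu> f = integral\<^sup>L (distr \<nu> borel (\<lambda>x. h + x)) f" by (simp only: \<nu>_inv[OF that])
    also have "\<dots> = F h" unfolding F_def by (rule integral_distr) measurable
    finally show ?thesis ..
  qed
  have F_c: "\<bar>F x\<bar> \<le> c" for x
    unfolding F_def
  proof (rule \<nu>.abs_expectation_le)
    show "integrable \<nu> (\<lambda>h. f (x + h))"
      by (rule \<nu>.integrable_const_bound[of _ c]) (use c in auto)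
  qed (use c in auto)
  have avg: "integral\<^sup>L (distr M borel (Y l)) f = (\<integral>\<omega>. F (Y l \<omega>) \<partial>M)" if l: "l \<le> 0" for l
  proof -
    note [measurable] = Y[OF l]
    have "(\<lambda>z. f (Y l (fst z) + snd z)) \<in> borel_measurable (M \<Otimes>\<^sub>M \<nu>)"
      by (intro measurable_compose[OF _ fm] borel_measurable_add) measurable
    then have "integrable (M \<Otimes>\<^sub>M \<nu>) (\<lambda>z. f (Y l (fst z) + snd z))"
      by (intro M\<nu>.P.integrable_const_bound[of _ c]) (use c in auto)
    then have int: "integrable (M \<Otimes>\<^sub>M \<nu>) (case_prod (\<lambda>\<omega> h. f (Y l \<omega> + h)))" by (simp add: split_beta')
    have "(\<integral>\<omega>. F (Y l \<omega>) \<partial>M) = (\<integral>h. \<integral>\<omega>. f (Y l \<omega> + h) \<partial>M \<partial>\<nu>)"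
      unfolding F_def using M\<nu>.Fubini_integral[OF int] by simp
    also have "\<dots> = (\<integral>h. integral\<^sup>L (distr M borel (Y l)) f \<partial>\<nu>)"
    proof (rule integral_cong_AE)
      have "closed H" using H compact_imp_closed by (auto simp: compact_subgroup_def)
      then have "H \<in> sets \<nu>" using sets by simp
      then have "AE h in \<nu>. h \<in> H"
        using \<nu>H by (subst \<nu>.prob_eq_1[symmetric]) (auto simp: measure_def)
      then show "AE h in \<nu>. (\<integral>\<omega>. f (Y l \<omega> + h) \<partial>M) = integral\<^sup>L (distr M borel (Y l)) f"
      proof eventually_elim
        case (elim h)
        have "(\<integral>\<omega>. f (Y l \<omega> + h) \<partial>M) = integral\<^sup>L (distr M borel (\<lambda>\<omega>. Y l \<omega> + h)) f"
          by (rule integral_distr[symmetric]) measurable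
        then show ?case using inv[OF l elim] by simp
      qed
      show "(\<lambda>h. \<integral>\<omega>. f (Y l \<omega> + h) \<partial>M) \<in> borel_measurable \<nu>"
        using M\<nu>.integrable_snd[OF int] by (simp add: borel_measurable_integrable)
    qed simp
    also have "\<dots> = integral\<^sup>L (distr M borel (Y l)) f" by (simp add: \<nu>.prob_space)
    finally show ?thesis ..
  qed
  have "(\<lambda>n. \<integral>\<omega>. F (Y (0 - int n) \<omega>) \<partial>M) \<longlonglongrightarrow> (\<integral>\<omega>. integral\<^sup>L \<nu> f \<partial>M)"
  proof (rule integral_dominated_convergence[where w="\<lambda>_. c"])
    show "AE \<omega> in M. (\<lambda>n. F (Y (0 - int n) \<omega>)) \<longlonglongrightarrow> integral\<^sup>L \<nu> f"
      using near
    proof eventually_elim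
      case (elim \<omega>)
      have "((\<lambda>l. F (Y l \<omega>)) \<longlongrightarrow> integral\<^sup>L \<nu> f) at_bot"
      proof (rule topological_tendstoI)
        fix S assume S: "open S" "integral\<^sup>L \<nu> f \<in> S"
        have "open (F -` S)" using F S(1) by (simp add: open_vimage)
        moreover have "H \<subseteq> F -` S" using F_H S(2) by auto
        ultimately have "\<forall>\<^sub>F l in at_bot. Y l \<omega> \<in> F -` S" using elim by blast
        then show "\<forall>\<^sub>F l in at_bot. F (Y l \<omega>) \<in> S" by simp
      qed
      moreover have "filterlim (\<lambda>n. 0 - int n) at_bot sequentially"
        unfolding filterlim_at_bot eventually_sequentially
      proof
        fix Z :: int
        show "\<exists>N. \<forall>n\<ge>N. 0 - int n \<le> Z" by (rule exI[of _ "nat (- Z)"]) auto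
      qed
      ultimately show ?case by (rule filterlim_compose)
    qed
    show "(\<lambda>\<omega>. F (Y (0 - int n) \<omega>)) \<in> borel_measurable M" for n
    proof -
      have [measurable]: "Y (0 - int n) \<in> borel_measurable M" by (rule Y) simp
      show ?thesis by measurable
    qed
  qed (use F_c in auto)
  then have "(\<lambda>n. integral\<^sup>L (distr M borel (Y (0 - int n))) f) \<longlonglongrightarrow> integral\<^sup>L \<nu> f"
    by (simp add: avg M.prob_space)
  then show "((\<lambda>l. integral\<^sup>L (distr M borel (Y l)) f) \<longlongrightarrow> integral\<^sup>L \<nu> f) at_bot"
    by (rule tendsto_at_bot_int)
qed

section \<open>Existence and uniqueness of the subgroup\<close>

lemma extremal_solution_existence:
  fixes \<mu> :: "int \<Rightarrow> 'a::{topological_group_add, t2_space, second_countable_topology} measure"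
  assumes cpt: "compact (UNIV :: 'a set)" and ext: "extremal_solution \<mu> M \<eta> \<xi>"
  shows "\<exists>\<alpha> H. compact_subgroup H \<and>
    cond_E1 M \<eta> \<xi> \<alpha> \<and> cond_E2 M \<eta> \<alpha> H \<and> cond_E3 M \<eta> H \<and> cond_E4 M \<eta> \<xi> \<alpha> H"
proof -
  have sol: "solution \<mu> M \<eta> \<xi>" using ext by (simp add: extremal_solution_def)
  interpret prob_space M by (rule solution_prob_space[OF sol])
  \<comment> \<open>Invariance is required of the marginals only; \<open>process_law_eqI\<close>
    lifts it to the path law for (E3).\<close>
  define H where "H = {h. \<forall>k\<in>{..0}. distr (distr M borel (\<eta> k)) borel (\<lambda>x. x + h) = distr M borel (\<eta> k)}"
  have H: "compact_subgroup H" unfolding H_def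
    using solution_measurable(1)[OF sol]
    by (intro compact_subgroup_stabilizer[OF cpt]) (auto intro!: prob_space_distr)
  have H_inv: "distr M borel (\<lambda>\<omega>. \<eta> k \<omega> + h) = distr M borel (\<eta> k)" if "h \<in> H" "k \<le> 0" for h k
  proof -
    have "distr (distr M borel (\<eta> k)) borel (\<lambda>x. x + h) = distr M borel (\<lambda>\<omega>. \<eta> k \<omega> + h)"
      using solution_measurable(1)[OF sol that(2)]
      by (subst distr_distr) (auto simp: comp_def intro!: borel_measurable_add)
    then show ?thesis using that by (simp add: H_def)
  qed
  have good: "AE \<omega> in M. cond_E1 M \<eta> \<xi> (\<lambda>l. \<eta> (l - 1) \<omega>)"
    by (rule extremal_solution_AE_weakly_converges[OF cpt ext])
  then have "AE \<omega> in M. \<exists>\<omega>. cond_E1 M \<eta> \<xi> (\<lambda>l. \<eta> (l - 1) \<omega>)" by eventually_elim blast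
  then obtain \<omega>0 where "cond_E1 M \<eta> \<xi> (\<lambda>l. \<eta> (l - 1) \<omega>0)" using not_AE_zero_E by auto
  then obtain \<alpha> where E1: "cond_E1 M \<eta> \<xi> \<alpha>" by blast
  have near: "AE \<omega> in M. \<forall>V. open V \<and> H \<subseteq> V \<longrightarrow> (\<forall>\<^sub>F l in at_bot. - \<alpha> l + \<eta> (l - 1) \<omega> \<in> V)"
    using good
  proof eventually_elim
    case (elim \<omega>)
    show ?case
      using eventually_diff_in_open[OF cpt sol E1 elim] unfolding H_def by blast
  qed
  have law0: "prob_space (distr M borel (\<eta> 0))" "sets (distr M borel (\<eta> 0)) = sets borel"
    using solution_measurable(1)[OF sol, of 0] by (auto intro: prob_space_distr)
  have "distr (distr M borel (\<eta> 0)) borel (\<lambda>x. x + h) = distr M borel (\<eta> 0)" if "h \<in> H" for h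
    using that by (simp add: H_def)
  then obtain \<nu> where \<nu>: "normalized_haar H \<nu>"
    using normalized_haar_exists[OF cpt H law0] by blast
  have "cond_E2 M \<eta> \<alpha> H" unfolding cond_E2_def
  proof (intro exI[of _ \<nu>] conjI \<nu> weakly_converges_haar[OF cpt H \<nu> prob_space_axioms _ _ near])
    fix l :: int assume l: "l \<le> 0"
    have [measurable]: "\<eta> (l - 1) \<in> borel_measurable M" using solution_measurable(1)[OF sol, of "l - 1"] l by simp
    show "(\<lambda>\<omega>. - \<alpha> l + \<eta> (l - 1) \<omega>) \<in> borel_measurable M" by measurable
    fix h assume h: "h \<in> H"
    have tr: "(\<lambda>x. - \<alpha> l + x) \<in> borel_measurable borel" by measurable
    have "distr M borel (\<lambda>\<omega>. - \<alpha> l + \<eta> (l - 1) \<omega> + h) = distr (distr M borel (\<lambda>\<omega>. \<eta> (l - 1) \<omega> + h)) borel (\<lambda>x. - \<alpha> l + x)"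
      by (subst distr_distr[OF tr]) (auto simp: comp_def add.assoc)
    also have "\<dots> = distr (distr M borel (\<eta> (l - 1))) borel (\<lambda>x. - \<alpha> l + x)"
      using H_inv[OF h, of "l - 1"] l by simp
    also have "\<dots> = distr M borel (\<lambda>\<omega>. - \<alpha> l + \<eta> (l - 1) \<omega>)"
      by (subst distr_distr[OF tr]) (auto simp: comp_def)
    finally show "distr M borel (\<lambda>\<omega>. - \<alpha> l + \<eta> (l - 1) \<omega> + h) = distr M borel (\<lambda>\<omega>. - \<alpha> l + \<eta> (l - 1) \<omega>)" .
  qed
  moreover have "cond_E3 M \<eta> H" unfolding cond_E3_def
    using H_inv by (intro ballI process_law_eqI[OF solution_translate[OF sol] sol])
  moreover have "cond_E4 M \<eta> \<xi> \<alpha> H" unfolding cond_E4_def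
  proof (intro allI impI)
    fix k :: int assume k: "k \<le> 0"
    have "AE \<omega> in M. \<forall>l\<in>{..k + 1}. noise_product \<xi> k l \<omega> = \<eta> k \<omega> - \<eta> (l - 1) \<omega>"
      using noise_product_eq_diff[OF sol k] by (subst AE_ball_countable) auto
    with near show "AE \<omega> in M. limitin (coset_topology H)
      (\<lambda>l. lcoset (noise_product \<xi> k l \<omega> + \<alpha> l) H) (lcoset (\<eta> k \<omega>) H) at_bot"
    proof eventually_elim
      case (elim \<omega>)
      show ?case unfolding limitin_def
      proof (intro conjI allI impI)
        show "lcoset (\<eta> k \<omega>) H \<in> topspace (coset_topology H)" by (simp add: topspace_coset_topology)
        fix U assume U: "openin (coset_topology H) U \<and> lcoset (\<eta> k \<omega>) H \<in> U"
        \<comment> \<open>The product \<open>noise_product \<xi> k l \<omega> + \<alpha> l\<close>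
          is \<open>\<eta> k \<omega>\<close> minus the variable that approaches \<open>H\<close>,
          so \<open>W\<close> is the pullback of \<open>U\<close> under this difference; it contains
          \<open>H\<close> because right translation by \<open>H\<close> preserves cosets.\<close>
        define W where "W = (\<lambda>x. \<eta> k \<omega> + - x) -` {g. lcoset g H \<in> U}"
        have "open W" unfolding W_def
          using U by (intro open_vimage continuous_intros) (simp add: openin_coset_topology)
        moreover have "H \<subseteq> W"
        proof
          fix h assume "h \<in> H"
          then have "- h \<in> H" using H by (simp add: compact_subgroup_def)
          then show "h \<in> W" using lcoset_right_translate[OF H, of "- h"] U by (simp add: W_def)
        qed
        ultimately have "\<forall>\<^sub>F l in at_bot. - \<alpha> l + \<eta> (l - 1) \<omega> \<in> W" using elim(1) by blast
        moreover have "\<forall>\<^sub>F l in at_bot. l \<le> k + 1" by (rule eventually_le_at_bot)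
        ultimately show "\<forall>\<^sub>F l in at_bot. lcoset (noise_product \<xi> k l \<omega> + \<alpha> l) H \<in> U"
        proof eventually_elim
          case (elim l)
          then have "noise_product \<xi> k l \<omega> = \<eta> k \<omega> - \<eta> (l - 1) \<omega>"
            using \<open>\<forall>l\<in>{..k + 1}. noise_product \<xi> k l \<omega> = \<eta> k \<omega> - \<eta> (l - 1) \<omega>\<close> by simp
          then have "noise_product \<xi> k l \<omega> + \<alpha> l = \<eta> k \<omega> + - (- \<alpha> l + \<eta> (l - 1) \<omega>)"
            by (simp add: minus_add diff_conv_add_uminus add.assoc del: add_uminus_conv_diff)
          then show ?case using elim(1) by (simp add: W_def)
        qed
      qed
    qed
  qed
  ultimately show ?thesis using H E1 by blast
qed

lemma extremal_solution_uniqueness: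
  fixes \<mu> :: "int \<Rightarrow> 'a::{topological_group_add, t2_space, second_countable_topology} measure"
  assumes cpt: "compact (UNIV :: 'a set)"
    and sol: "solution \<mu> M \<eta> \<xi>" and H: "compact_subgroup H"
    and E1: "cond_E1 M \<eta> \<xi> \<alpha>" and E2: "cond_E2 M \<eta> \<alpha> H"
    and sol': "solution \<mu> M' \<eta>' \<xi>'" and H': "compact_subgroup H'"
    and E1': "cond_E1 M' \<eta>' \<xi>' \<alpha>'" and E2': "cond_E2 M' \<eta>' \<alpha>' H'"
    and l: "filterlim l at_bot sequentially" and g: "(\<lambda>j::nat. - \<alpha> (l j) + \<alpha>' (l j)) \<longlonglongrightarrow> g"
  shows "process_law M' \<eta>' = process_law M (\<lambda>k \<omega>. \<eta> k \<omega> + g)"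
    and "H' = (\<lambda>h. - g + h + g) ` H"
proof -
  interpret M: prob_space M by (rule solution_prob_space[OF sol])
  interpret M': prob_space M' by (rule solution_prob_space[OF sol'])
  have law: "distr M' borel (\<eta>' k) = distr M borel (\<lambda>\<omega>. \<eta> k \<omega> + g)" if k: "k \<le> 0" for k
  proof (rule weakly_converges_unique[OF cpt])
    note [measurable] = solution_measurable(1)[OF sol k] solution_measurable(1)[OF sol' k]
    show "weakly_converges (\<lambda>j. distr M borel (\<lambda>\<omega>. noise_product \<xi> k (l j) \<omega> + \<alpha>' (l j)))
      (distr M borel (\<lambda>\<omega>. \<eta> k \<omega> + g)) sequentially"
      by (rule weakly_converges_noise_shift[OF cpt sol E1 k l g])
    have "weakly_converges (\<lambda>j. distr M' borel (\<lambda>\<omega>. noise_product \<xi>' k (l j) \<omega> + \<alpha>' (l j)))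
      (distr M' borel (\<eta>' k)) sequentially"
      using E1' k weakly_converges_compose[OF _ l] by (auto simp: cond_E1_def)
    then show "weakly_converges (\<lambda>j. distr M borel (\<lambda>\<omega>. noise_product \<xi> k (l j) \<omega> + \<alpha>' (l j)))
      (distr M' borel (\<eta>' k)) sequentially"
      by (simp only: noise_product_law_unique[OF sol sol' k])
    show "prob_space (distr M' borel (\<eta>' k))" by (rule M'.prob_space_distr) measurable
    show "prob_space (distr M borel (\<lambda>\<omega>. \<eta> k \<omega> + g))" by (rule M.prob_space_distr) measurable
  qed auto
  show "process_law M' \<eta>' = process_law M (\<lambda>k \<omega>. \<eta> k \<omega> + g)"
    by (rule process_law_eqI[OF sol' solution_translate[OF sol] law])
  obtain \<nu> where \<nu>: "normalized_haar H \<nu>"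
    and w: "weakly_converges (\<lambda>l. distr M borel (\<lambda>\<omega>. - \<alpha> l + \<eta> (l - 1) \<omega>)) \<nu> at_bot"
    using E2 by (auto simp: cond_E2_def)
  obtain \<nu>' where \<nu>': "normalized_haar H' \<nu>'"
    and w': "weakly_converges (\<lambda>l. distr M' borel (\<lambda>\<omega>. - \<alpha>' l + \<eta>' (l - 1) \<omega>)) \<nu>' at_bot"
    using E2' by (auto simp: cond_E2_def)
  have sets: "sets \<nu> = sets borel" "prob_space \<nu>" "sets \<nu>' = sets borel" "prob_space \<nu>'"
    using \<nu> \<nu>' by (auto simp: normalized_haar_def)
  let ?\<nu>g = "distr \<nu> borel (\<lambda>x. - g + x + g)"
  have haar: "normalized_haar ((\<lambda>h. - g + h + g) ` H) ?\<nu>g" by (rule normalized_haar_conj[OF H \<nu>])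
  have "\<nu>' = ?\<nu>g"
  proof (rule weakly_converges_unique[OF cpt])
    \<comment> \<open>Truncation at 0 makes every index admissible, as measurability is known only
      for non-positive times; it alters finitely many terms.\<close>
    define k where "k j = min (l j) 0" for j
    have ev: "\<forall>\<^sub>F j in sequentially. l j = k j"
      using filterlim_at_bot[THEN iffD1, OF l, rule_format, of 0] by eventually_elim (simp add: k_def)
    have k: "filterlim k at_bot sequentially"
      using l ev by (simp cong: filterlim_cong)
    have kg: "(\<lambda>j. - \<alpha> (k j) + \<alpha>' (k j)) \<longlonglongrightarrow> g"
      by (rule Lim_transform_eventually[OF g]) (use ev in eventually_elim, simp)
    have k0: "k j - 1 \<le> 0" for j by (simp add: k_def)
    note [measurable] = solution_measurable(1)[OF sol k0] solution_measurable(1)[OF sol' k0]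
    let ?c = "\<lambda>(y, x). - y + x + g"
    let ?P = "\<lambda>j. distr M borel (\<lambda>\<omega>. - \<alpha> (k j) + \<eta> (k j - 1) \<omega>)"
    have tr: "(\<lambda>x. a + x + b) \<in> borel_measurable borel" for a b :: 'a by measurable
    show "weakly_converges (\<lambda>j. distr M' borel (\<lambda>\<omega>. - \<alpha>' (k j) + \<eta>' (k j - 1) \<omega>)) \<nu>' sequentially"
      by (rule weakly_converges_compose[OF w' k])
    have "weakly_converges (\<lambda>j. distr (?P j) borel (\<lambda>x. ?c (- \<alpha> (k j) + \<alpha>' (k j), x)))
      (distr \<nu> borel (\<lambda>x. ?c (g, x))) sequentially"
    proof (rule weakly_converges_distr_pair[OF cpt _ _ _ sets(1) weakly_converges_compose[OF w k] kg])
      show "continuous_on UNIV ?c" by (auto simp: split_beta' intro!: continuous_intros)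
      show "prob_space (?P j)" for j by (rule M.prob_space_distr) measurable
    qed simp
    \<comment> \<open>With \<open>\<eta>'\<close> distributed as \<open>\<eta> + g\<close>, the
      variable \<open>- \<alpha>' + \<eta>'\<close> arises from \<open>- \<alpha> + \<eta>\<close>
      by left translation with \<open>- (- \<alpha> + \<alpha>')\<close> and right translation with
      \<open>g\<close>. In the limit this is conjugation by \<open>g\<close>.\<close>
    moreover have "distr (?P j) borel (\<lambda>x. ?c (- \<alpha> (k j) + \<alpha>' (k j), x)) =
        distr M' borel (\<lambda>\<omega>. - \<alpha>' (k j) + \<eta>' (k j - 1) \<omega>)" for j
    proof -
      have "distr M' borel (\<lambda>\<omega>. - \<alpha>' (k j) + \<eta>' (k j - 1) \<omega>) =
          distr (distr M' borel (\<eta>' (k j - 1))) borel (\<lambda>x. - \<alpha>' (k j) + x)"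
        by (subst distr_distr) (auto simp: comp_def)
      also have "\<dots> = distr (distr M borel (\<lambda>\<omega>. \<eta> (k j - 1) \<omega> + g)) borel (\<lambda>x. - \<alpha>' (k j) + x)"
        by (simp only: law[OF k0])
      also have "\<dots> = distr M borel (\<lambda>\<omega>. - \<alpha>' (k j) + (\<eta> (k j - 1) \<omega> + g))"
        by (subst distr_distr) (auto simp: comp_def)
      also have "\<dots> = distr (?P j) borel (\<lambda>x. ?c (- \<alpha> (k j) + \<alpha>' (k j), x))"
        unfolding prod.case by (subst distr_distr[OF tr]) (auto simp: comp_def minus_add add.assoc)
      finally show ?thesis ..
    qed
    ultimately show "weakly_converges (\<lambda>j. distr M' borel (\<lambda>\<omega>. - \<alpha>' (k j) + \<eta>' (k j - 1) \<omega>)) ?\<nu>g sequentially"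
      by simp
  qed (use sets haar in \<open>auto simp: normalized_haar_def\<close>)
  then show "H' = (\<lambda>h. - g + h + g) ` H"
    using normalized_haar_subgroup_subset[OF H' _ compact_subgroup_conj[OF H] haar]
      normalized_haar_subgroup_subset[OF compact_subgroup_conj[OF H] haar H'] \<nu>'
    by (intro equalityI) simp_all
qed

theorem theorem2p2:
  fixes \<mu> :: "int \<Rightarrow> 'a::{topological_group_add, t2_space, second_countable_topology} measure"
    and M :: "'w measure"
    and \<eta> \<xi> :: "int \<Rightarrow> 'w \<Rightarrow> 'a"
  assumes "compact (UNIV :: 'a set)"
    and "\<exists>x y :: 'a. x \<noteq> y"
    and "\<And>k. k \<le> 0 \<Longrightarrow> prob_space (\<mu> k)"
    and "\<And>k. k \<le> 0 \<Longrightarrow> sets (\<mu> k) = sets borel"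
    and "extremal_solution \<mu> M \<eta> \<xi>"
  shows "(\<exists>\<alpha> H. compact_subgroup H \<and>
            cond_E1 M \<eta> \<xi> \<alpha> \<and> cond_E2 M \<eta> \<alpha> H \<and> cond_E3 M \<eta> H \<and> cond_E4 M \<eta> \<xi> \<alpha> H) \<and>
         (\<forall>\<alpha> H. compact_subgroup H \<and>
            cond_E1 M \<eta> \<xi> \<alpha> \<and> cond_E2 M \<eta> \<alpha> H \<and> cond_E3 M \<eta> H \<and> cond_E4 M \<eta> \<xi> \<alpha> H \<longrightarrow>
           (\<forall>(M' :: 'v measure) \<eta>' \<xi>' \<alpha>' H'.
              extremal_solution \<mu> M' \<eta>' \<xi>' \<and> compact_subgroup H' \<and>
              cond_E1 M' \<eta>' \<xi>' \<alpha>' \<and> cond_E2 M' \<eta>' \<alpha>' H' \<and> cond_E3 M' \<eta>' H' \<and>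
              cond_E4 M' \<eta>' \<xi>' \<alpha>' H' \<longrightarrow>
             (\<forall>g. (\<exists>l :: nat \<Rightarrow> int. filterlim l at_bot sequentially \<and>
                      (\<lambda>j. - \<alpha> (l j) + \<alpha>' (l j)) \<longlonglongrightarrow> g) \<longrightarrow>
                process_law M' \<eta>' = process_law M (\<lambda>k \<omega>. \<eta> k \<omega> + g) \<and>
                H' = (\<lambda>h. - g + h + g) ` H)))"
proof (intro conjI allI impI)
  show "\<exists>\<alpha> H. compact_subgroup H \<and>
      cond_E1 M \<eta> \<xi> \<alpha> \<and> cond_E2 M \<eta> \<alpha> H \<and> cond_E3 M \<eta> H \<and> cond_E4 M \<eta> \<xi> \<alpha> H"
    by (rule extremal_solution_existence[OF assms(1,5)])
next
  fix \<alpha> H and M' :: "'v measure" and \<eta>' \<xi>' \<alpha>' H' g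
  assume A: "compact_subgroup H \<and>
      cond_E1 M \<eta> \<xi> \<alpha> \<and> cond_E2 M \<eta> \<alpha> H \<and> cond_E3 M \<eta> H \<and> cond_E4 M \<eta> \<xi> \<alpha> H"
    and A': "extremal_solution \<mu> M' \<eta>' \<xi>' \<and> compact_subgroup H' \<and>
      cond_E1 M' \<eta>' \<xi>' \<alpha>' \<and> cond_E2 M' \<eta>' \<alpha>' H' \<and> cond_E3 M' \<eta>' H' \<and> cond_E4 M' \<eta>' \<xi>' \<alpha>' H'"
    and "\<exists>l :: nat \<Rightarrow> int. filterlim l at_bot sequentially \<and> (\<lambda>j. - \<alpha> (l j) + \<alpha>' (l j)) \<longlonglongrightarrow> g"
  then obtain l where l: "filterlim l at_bot sequentially" "(\<lambda>j::nat. - \<alpha> (l j) + \<alpha>' (l j)) \<longlonglongrightarrow> g" by blast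
  have sol: "solution \<mu> M \<eta> \<xi>" "solution \<mu> M' \<eta>' \<xi>'"
    using assms(5) A' by (auto simp: extremal_solution_def)
  show "process_law M' \<eta>' = process_law M (\<lambda>k \<omega>. \<eta> k \<omega> + g)" "H' = (\<lambda>h. - g + h + g) ` H"
    using extremal_solution_uniqueness[OF assms(1) sol(1) _ _ _ sol(2) _ _ _ l] A A' by blast+
qed

end
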